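(* Let $n\ge5$ and let $I$ be a squarefree strongly stable ideal of $S=K[x_1,\ldots,x_n]$ ($K$ a field) with initial degree $\ell\ge3$ and with a corner in degree $\ell$. Then $I$ has at most $n-\ell$ corners.
   Context: For a monomial $u$, $\mathrm{supp}(u)=\{i: x_i\mid u\}$. For a monomial ideal $I$, $G(I)$ is its minimal set of monomial generators. A squarefree monomial ideal $I$ (i.e. generated by squarefree monomials) is squarefree strongly stable if for all $u\in G(I)$ one has $(x_ju)/x_i\in I$ for all $i\in\mathrm{supp}(u)$ and all $j<i$ with $j\notin\mathrm{supp}(u)$. The initial degree of a graded ideal $I$ is the minimum $j$ with $I_j\ne0$. For a graded ideal $I$, $\beta_{i,j}(I)=\dim_K\mathrm{Tor}_i(K,I)_j$. A graded Betti number $\beta_{k,k+\ell}(I)\ne0$ is extremal if $\beta_{i,i+j}(I)=0$ for all $i\ge k$, $j\ge\ell$, $(i,j)\ne(k,\ell)$; the pair $(k,\ell)$ is then called a corner of $I$ (a corner in degree $\ell$).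
   Formalization: The initial degree ℓ is assumed to be less than n; this excludes only the ideal I=(x_1⋯x_n), where ℓ=n and the single corner (0,n) exceeds the bound n−ℓ=0, so the claim fails there. *)

theory Defs
  imports
    Complex_Main
    "HOL-Algebra.Ideal"
    "HOL-Library.Poly_Mapping"
    "HOL-Library.Function_Algebras"
begin

section \<open>Polynomials and monomial ideals\<close>

type_synonym monomial = "nat \<Rightarrow>\<^sub>0 nat"

text \<open>Polynomials in the variables \<open>x\<^sub>0, x\<^sub>1, \<dots>\<close>, as finitely supported functions from exponent
  vectors to coefficients; the product of this type is the convolution product.\<close>

type_synonym 'a mpoly = "monomial \<Rightarrow>\<^sub>0 'a"

definition monomials :: "nat \<Rightarrow> monomial set" where
  "monomials n = {u. Poly_Mapping.keys u \<subseteq> {1..n}}"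

text \<open>The ring \<open>S = K[x\<^sub>1, \<dots>, x\<^sub>n]\<close>.\<close>

definition polys :: "nat \<Rightarrow> 'a::field mpoly set" where
  "polys n = {p. Poly_Mapping.keys p \<subseteq> monomials n}"

definition poly_ring :: "nat \<Rightarrow> 'a::field mpoly ring" where
  "poly_ring n = \<lparr>carrier = polys n, mult = (*), one = 1, zero = 0, add = (+)\<rparr>"

lemma cring_poly_ring: "cring (poly_ring n :: 'a::field mpoly ring)"
proof -
  have add: "p + q \<in> polys n" if "p \<in> polys n" "q \<in> polys n" for p q :: "'a mpoly"
    using that Poly_Mapping.keys_add[of p q] unfolding polys_def by blast
  have mult: "p * q \<in> polys n" if "p \<in> polys n" "q \<in> polys n" for p q :: "'a mpoly"
  proof -
    have "u + w \<in> monomials n" if "u \<in> monomials n" "w \<in> monomials n" for u w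
      using that Poly_Mapping.keys_add[of u w] unfolding monomials_def by blast
    with that keys_mult[of p q] show ?thesis
      unfolding polys_def by blast
  qed
  have neg: "- p \<in> polys n" if "p \<in> polys n" for p :: "'a mpoly"
    using that by (simp add: polys_def)
  have const: "0 \<in> polys n" "1 \<in> polys n"
    by (auto simp: polys_def monomials_def keys_one)
  show ?thesis
    by (rule cringI; (rule abelian_groupI comm_monoidI)?)
      (auto simp: poly_ring_def add mult const algebra_simps intro!: bexI[OF _ neg])
qed

definition mon :: "monomial \<Rightarrow> 'a::field mpoly" where
  "mon u = Poly_Mapping.single u 1"

definition tdeg :: "monomial \<Rightarrow> nat" where
  "tdeg u = (\<Sum>i\<in>Poly_Mapping.keys u. Poly_Mapping.lookup u i)"

definition monomial_ideal :: "nat \<Rightarrow> monomial set \<Rightarrow> 'a::field mpoly set" where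
  "monomial_ideal n M = Idl\<^bsub>poly_ring n\<^esub> (mon ` M)"

text \<open>\<open>G(I)\<close>, the minimal set of monomial generators of a monomial ideal \<open>I\<close>.\<close>

definition min_gens :: "nat \<Rightarrow> 'a::field mpoly set \<Rightarrow> monomial set" where
  "min_gens n I = (THE G. G \<subseteq> monomials n \<and> monomial_ideal n G = I \<and>
     (\<forall>H. H \<subset> G \<longrightarrow> monomial_ideal n H \<noteq> I))"

definition squarefree_monomial :: "monomial \<Rightarrow> bool" where
  "squarefree_monomial u \<longleftrightarrow> (\<forall>i. Poly_Mapping.lookup u i \<le> 1)"

definition squarefree_monomial_ideal :: "nat \<Rightarrow> 'a::field mpoly set \<Rightarrow> bool" where
  "squarefree_monomial_ideal n I \<longleftrightarrow>
     (\<exists>M. M \<subseteq> monomials n \<and> (\<forall>u\<in>M. squarefree_monomial u) \<and> I = monomial_ideal n M)"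

text \<open>Here \<open>Poly_Mapping.keys u\<close> is \<open>supp(u)\<close>, and the exponent vector of \<open>(x\<^sub>j u)/x\<^sub>i\<close> is formed with the
  pointwise (truncated) subtraction, which is exact because \<open>i \<in> supp(u)\<close>.\<close>

definition squarefree_strongly_stable :: "nat \<Rightarrow> 'a::field mpoly set \<Rightarrow> bool" where
  "squarefree_strongly_stable n I \<longleftrightarrow> squarefree_monomial_ideal n I \<and>
     (\<forall>u\<in>min_gens n I. \<forall>i\<in>Poly_Mapping.keys u. \<forall>j\<in>{1..<i}. j \<notin> Poly_Mapping.keys u \<longrightarrow>
        mon (Poly_Mapping.single j 1 + u - Poly_Mapping.single i 1) \<in> I)"

definition hom_comp :: "'a::field mpoly set \<Rightarrow> nat \<Rightarrow> 'a mpoly set" where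
  "hom_comp I j = {p\<in>I. \<forall>u\<in>Poly_Mapping.keys p. tdeg u = j}"

definition has_initial_degree :: "'a::field mpoly set \<Rightarrow> nat \<Rightarrow> bool" where
  "has_initial_degree I l \<longleftrightarrow> hom_comp I l \<noteq> {0} \<and> (\<forall>j<l. hom_comp I j = {0})"


section \<open>Graded Betti numbers\<close>

text \<open>A complex \<open>\<dots> \<longrightarrow> F\<^sub>2 \<longrightarrow> F\<^sub>1 \<longrightarrow> F\<^sub>0\<close> of graded free \<open>S\<close>-modules of finite rank: \<open>F\<^sub>i\<close> has the
  basis \<open>e\<^sub>0, \<dots>, e\<^sub>r\<^sub>-\<^sub>1\<close> with \<open>r = rk F i\<close>, the degree of \<open>e\<^sub>b\<close> is \<open>gdeg F i b\<close>, and the differential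
  \<open>F\<^sub>i\<^sub>+\<^sub>1 \<longrightarrow> F\<^sub>i\<close> sends \<open>e\<^sub>b\<close> to the sum of the \<open>coef F i b c\<close> times \<open>e\<^sub>c\<close>.\<close>

record (overloaded) 'a free_complex =
  rk :: "nat \<Rightarrow> nat"
  gdeg :: "nat \<Rightarrow> nat \<Rightarrow> nat"
  coef :: "nat \<Rightarrow> nat \<Rightarrow> nat \<Rightarrow> 'a mpoly"

text \<open>For an ideal \<open>I\<close> (including \<open>I = S\<close>) the module \<open>F\<^sub>i \<otimes>\<^sub>S I\<close> is the direct sum of \<open>rk F i\<close>
  copies of \<open>I\<close>; its elements are coordinate vectors, padded by \<open>0\<close>.\<close>

definition chains :: "'a::field free_complex \<Rightarrow> 'a mpoly set \<Rightarrow> nat \<Rightarrow> (nat \<Rightarrow> 'a mpoly) set" where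
  "chains F I i = {v. (\<forall>b<rk F i. v b \<in> I) \<and> (\<forall>b\<ge>rk F i. v b = 0)}"

definition bdry :: "'a::field free_complex \<Rightarrow> nat \<Rightarrow> (nat \<Rightarrow> 'a mpoly) \<Rightarrow> (nat \<Rightarrow> 'a mpoly)" where
  "bdry F i v = (\<lambda>c. if c < rk F i then (\<Sum>b<rk F (Suc i). v b * coef F i b c) else 0)"

definition chains_deg ::
    "'a::field free_complex \<Rightarrow> 'a mpoly set \<Rightarrow> nat \<Rightarrow> nat \<Rightarrow> (nat \<Rightarrow> 'a mpoly) set" where
  "chains_deg F I i j =
     {v \<in> chains F I i. \<forall>b<rk F i. \<forall>u\<in>Poly_Mapping.keys (v b). tdeg u + gdeg F i b = j}"

text \<open>The \<open>S\<close>-module \<open>K = S/(x\<^sub>1, \<dots>, x\<^sub>n)\<close> sits in degree \<open>0\<close> and a polynomial acts on it through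
  its constant coefficient. The following is the \<open>S\<close>-linear map \<open>F\<^sub>0 \<longrightarrow> K\<close> with \<open>e\<^sub>b \<mapsto> a b\<close>.\<close>

definition augm :: "'a::field free_complex \<Rightarrow> (nat \<Rightarrow> 'a) \<Rightarrow> (nat \<Rightarrow> 'a mpoly) \<Rightarrow> 'a" where
  "augm F a v = (\<Sum>b<rk F 0. Poly_Mapping.lookup (v b) 0 * a b)"

text \<open>\<open>F\<close> is a graded free resolution of the residue field \<open>K\<close>: the differentials and the
  augmentation are homogeneous of degree \<open>0\<close>, and \<open>\<dots> \<longrightarrow> F\<^sub>1 \<longrightarrow> F\<^sub>0 \<longrightarrow> K \<longrightarrow> 0\<close> is exact.\<close>

definition resolves_field :: "nat \<Rightarrow> 'a::field free_complex \<Rightarrow> bool" where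
  "resolves_field n F \<longleftrightarrow>
     (\<forall>i. \<forall>b<rk F (Suc i). \<forall>c<rk F i. coef F i b c \<in> polys n \<and>
        (\<forall>u\<in>Poly_Mapping.keys (coef F i b c). tdeg u + gdeg F i c = gdeg F (Suc i) b)) \<and>
     (\<forall>i. {v \<in> chains F (polys n) (Suc i). bdry F i v = 0} =
        bdry F (Suc i) ` chains F (polys n) (Suc (Suc i))) \<and>
     (\<exists>a. (\<forall>b<rk F 0. a b \<noteq> 0 \<longrightarrow> gdeg F 0 b = 0) \<and>
        augm F a ` chains F (polys n) 0 = UNIV \<and>
        {v \<in> chains F (polys n) 0. augm F a v = 0} = bdry F 0 ` chains F (polys n) (Suc 0))"

text \<open>\<open>Tor\<^sub>i(K, I)\<close> is the homology of \<open>F \<otimes>\<^sub>S I\<close> for a graded free resolution \<open>F\<close> of \<open>K\<close>; up to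
  isomorphism it does not depend on \<open>F\<close>.\<close>

definition tor_cycles ::
    "'a::field free_complex \<Rightarrow> 'a mpoly set \<Rightarrow> nat \<Rightarrow> nat \<Rightarrow> (nat \<Rightarrow> 'a mpoly) set" where
  "tor_cycles F I i j =
     {v \<in> chains_deg F I i j. case i of 0 \<Rightarrow> True | Suc k \<Rightarrow> bdry F k v = 0}"

definition tor_boundaries ::
    "'a::field free_complex \<Rightarrow> 'a mpoly set \<Rightarrow> nat \<Rightarrow> nat \<Rightarrow> (nat \<Rightarrow> 'a mpoly) set" where
  "tor_boundaries F I i j = bdry F i ` chains_deg F I (Suc i) j"

definition vscale :: "'a::field \<Rightarrow> (nat \<Rightarrow> 'a mpoly) \<Rightarrow> (nat \<Rightarrow> 'a mpoly)" where
  "vscale a v = (\<lambda>b. Poly_Mapping.single 0 a * v b)"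

lemma vector_space_vscale: "vector_space (vscale :: 'a::field \<Rightarrow> _)"
  by unfold_locales
    (auto simp: vscale_def fun_eq_iff distrib_left distrib_right single_add
      mult.assoc[symmetric] mult_single)

text \<open>\<open>\<beta>\<^sub>i\<^sub>,\<^sub>j(I) = dim\<^sub>K Tor\<^sub>i(K, I)\<^sub>j\<close>. The boundaries form a subspace of the cycles, and both are
  finite-dimensional because the graded pieces of \<open>S\<close> are.\<close>

definition betti :: "nat \<Rightarrow> 'a::field mpoly set \<Rightarrow> nat \<Rightarrow> nat \<Rightarrow> nat" where
  "betti n I i j = (let F = (SOME F. resolves_field n F) in
     vector_space.dim vscale (tor_cycles F I i j) -
     vector_space.dim vscale (tor_boundaries F I i j))"

definition is_corner :: "nat \<Rightarrow> 'a::field mpoly set \<Rightarrow> nat \<Rightarrow> nat \<Rightarrow> bool" where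
  "is_corner n I k l \<longleftrightarrow> betti n I k (k + l) \<noteq> 0 \<and>
     (\<forall>i\<ge>k. \<forall>j\<ge>l. (i, j) \<noteq> (k, l) \<longrightarrow> betti n I i (i + j) = 0)"

end

theory Submission
  imports Defs
begin

text \<open>A corner in degree \<open>j\<close> is unique, since of two corners in the same degree one dominates the
  other. So it suffices that a corner \<open>(k, j)\<close> has \<open>l \<le> j < n\<close>, and this holds for every squarefree
  monomial ideal \<open>I\<close>: \<open>\<beta>\<^sub>k\<^sub>,\<^sub>k\<^sub>+\<^sub>j(I)\<close> vanishes for \<open>j < l\<close> and for \<open>k + j > n\<close>, which leaves \<open>(0, n)\<close>
  to be excluded; but \<open>I\<close> has a generator of degree at most \<open>l < n\<close>, which divides \<open>x\<^sub>1 \<cdots> x\<^sub>n\<close>, so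
  \<open>x\<^sub>1 \<cdots> x\<^sub>n\<close> is not a minimal generator.

  The vanishing is read off from the Koszul complex. Its part of multidegree \<open>a\<close> is the chain complex
  of a simplex on the support of \<open>a\<close>, which the contraction to a vertex \<open>j\<close> makes acyclic; the contraction
  divides coefficients by \<open>x\<^sub>j\<close>, and so preserves \<open>I\<close> if \<open>a\<close> is divisible by \<open>x\<^sub>j\<^sup>2\<close>. Since
  \<^const>\<open>betti\<close> refers to an arbitrary resolution of the residue field, the vanishing is transferred
  to it by a comparison of resolutions: chain maps in both directions, and a homotopy between
  their composition and the identity.\<close>

abbreviation keys :: "('b \<Rightarrow>\<^sub>0 'c::zero) \<Rightarrow> 'b set" where
  "keys \<equiv> Poly_Mapping.keys"

abbreviation lookup :: "('b \<Rightarrow>\<^sub>0 'c::zero) \<Rightarrow> 'b \<Rightarrow> 'c" where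
  "lookup \<equiv> Poly_Mapping.lookup"

abbreviation single :: "'b \<Rightarrow> 'c \<Rightarrow> 'b \<Rightarrow>\<^sub>0 'c::zero" where
  "single \<equiv> Poly_Mapping.single"

abbreviation var :: "nat \<Rightarrow> monomial" where
  "var j \<equiv> single j 1"

section \<open>Monomials and polynomials\<close>

lemma tdeg_superset:
  assumes "finite A" "keys u \<subseteq> A"
  shows "tdeg u = (\<Sum>i\<in>A. lookup u i)"
  unfolding tdeg_def using assms by (intro sum.mono_neutral_left) (auto simp: in_keys_iff)

lemma tdeg_add: "tdeg (u + w) = tdeg u + tdeg w"
proof -
  have "tdeg v = (\<Sum>i\<in>keys u \<union> keys w. lookup v i)" if "v \<in> {u, w, u + w}" for v
    using that Poly_Mapping.keys_add[of u w] by (intro tdeg_superset) auto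
  thus ?thesis by (simp add: lookup_add sum.distrib)
qed

lemma tdeg_0 [simp]: "tdeg 0 = 0"
  by (simp add: tdeg_def)

lemma tdeg_single [simp]: "tdeg (single j c) = c"
  by (simp add: tdeg_def)

lemma tdeg_eq_0_iff: "tdeg u = 0 \<longleftrightarrow> u = 0"
proof
  assume "tdeg u = 0"
  hence "\<forall>i\<in>keys u. lookup u i = 0"
    by (simp add: tdeg_def)
  hence "keys u = {}"
    by (meson all_not_in_conv in_keys_iff)
  thus "u = 0"
    by simp
qed simp

lemma keys_add_monomial: "keys (u + w) = keys u \<union> keys w" for u w :: monomial
  by (auto simp: in_keys_iff lookup_add)

lemma monomials_add_iff: "u + w \<in> monomials n \<longleftrightarrow> u \<in> monomials n \<and> w \<in> monomials n"
  by (simp add: monomials_def keys_add_monomial)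

lemma minus_var_add_var: "j \<in> keys u \<Longrightarrow> u - var j + var j = u" for u :: monomial
  by (rule poly_mapping_eqI) (auto simp: lookup_add lookup_minus lookup_single in_keys_iff when_def)

lemma poly_eq_sum_single: "p = (\<Sum>u\<in>keys p. single u (lookup p u))"
  by (rule poly_mapping_eqI) (simp add: lookup_sum lookup_single when_def in_keys_iff)

lemma lookup_mult_single_add:
  fixes p :: "monomial \<Rightarrow>\<^sub>0 'a::semiring_0"
  shows "lookup (p * single m c) (u + m) = lookup p u * c"
proof -
  have "lookup (p * single m c) (u + m) =
      (\<Sum>w\<in>keys p. lookup (single w (lookup p w) * single m c) (u + m))"
    by (subst (1) poly_eq_sum_single[of p]) (simp add: sum_distrib_right lookup_sum)
  also have "\<dots> = (\<Sum>w\<in>keys p. if u = w then lookup p w * c else 0)"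
    by (rule sum.cong) (auto simp: mult_single lookup_single when_def)
  finally show ?thesis
    by (auto simp: sum.delta in_keys_iff)
qed

lemma lookup_mult_single_var:
  fixes p :: "monomial \<Rightarrow>\<^sub>0 'a::semiring_0"
  shows "lookup (p * single (var j) c) u = (if j \<in> keys u then lookup p (u - var j) * c else 0)"
proof (cases "j \<in> keys u")
  case True
  thus ?thesis
    using lookup_mult_single_add[of p "var j" c "u - var j"] minus_var_add_var[of j u] by simp
next
  case False
  have "u \<notin> keys (p * single (var j) c)"
  proof
    assume "u \<in> keys (p * single (var j) c)"
    then obtain w v where "u = w + v" "v \<in> keys (single (var j) c)"
      using keys_mult[of p "single (var j) c"] by blast
    hence "u = w + var j"
      by (auto split: if_splits)
    with False show False
      by (simp add: keys_add_monomial)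
  qed
  with False show ?thesis
    by (simp add: in_keys_iff)
qed

text \<open>Exponents are natural numbers, so a product of monomials is 1 only if both factors are
  1. This makes \<open>augm\<close> compatible with multiplication by polynomials.\<close>

lemma lookup_0_mult: "lookup (p * q) 0 = lookup p 0 * lookup q 0"
  for p q :: "'a::semiring_0 mpoly"
proof -
  have "lookup (single u c * q) 0 = (if u = 0 then c * lookup q 0 else 0)" for u c
  proof (cases "u = 0")
    case True
    have "single u c * q = (\<Sum>w\<in>keys q. single w (c * lookup q w))"
      by (subst (1) poly_eq_sum_single[of q])
        (simp add: sum_distrib_left mult_single True)
    thus ?thesis
      using True by (auto simp: lookup_sum lookup_single when_def in_keys_iff)
  next
    case False
    have "0 \<notin> keys (single u c * q)"
    proof
      assume "0 \<in> keys (single u c * q)"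
      then obtain w v where "0 = w + v" "w \<in> keys (single u c)"
        using keys_mult[of "single u c" q] by blast
      hence "tdeg u + tdeg v = 0"
        by (metis Poly_Mapping.keys_single emptyE singletonD tdeg_0 tdeg_add)
      with False show False
        by (simp add: tdeg_eq_0_iff)
    qed
    with False show ?thesis
      by (simp add: in_keys_iff)
  qed
  note single = this
  have "lookup (p * q) 0 = (\<Sum>u\<in>keys p. lookup (single u (lookup p u) * q) 0)"
    by (subst (1) poly_eq_sum_single[of p]) (simp add: sum_distrib_right lookup_sum)
  also have "\<dots> = (\<Sum>u\<in>keys p. if u = 0 then lookup p u * lookup q 0 else 0)"
    by (simp add: single)
  finally show ?thesis
    by (auto simp: in_keys_iff)
qed

section \<open>Homogeneous components of polynomials\<close>

definition part :: "(monomial \<Rightarrow> bool) \<Rightarrow> 'a::zero mpoly \<Rightarrow> 'a mpoly" where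
  "part P p = Poly_Mapping.mapp (\<lambda>u c. if P u then c else 0) p"

lemma lookup_part: "lookup (part P p) u = (if P u then lookup p u else 0)"
  by (simp add: part_def lookup_mapp when_def in_keys_iff)

lemma keys_part: "keys (part P p) = {u \<in> keys p. P u}"
  by (auto simp: in_keys_iff lookup_part split: if_splits)

lemma part_add: "part P (p + q) = part P p + part P q" for p q :: "'a::monoid_add mpoly"
  by (rule poly_mapping_eqI) (simp add: lookup_part lookup_add)

lemma part_sum: "part P (\<Sum>i\<in>A. f i) = (\<Sum>i\<in>A. part P (f i))"
  for f :: "_ \<Rightarrow> 'a::comm_monoid_add mpoly"
  by (rule poly_mapping_eqI) (simp add: lookup_part lookup_sum)

lemma part_ident: "(\<And>u. u \<in> keys p \<Longrightarrow> P u) \<Longrightarrow> part P p = p"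
  by (rule poly_mapping_eqI) (auto simp: lookup_part in_keys_iff)

lemma part_eq_0: "(\<And>u. u \<in> keys p \<Longrightarrow> \<not> P u) \<Longrightarrow> part P p = 0"
  by (rule poly_mapping_eqI) (auto simp: lookup_part in_keys_iff)

text \<open>Every monomial of \<open>q\<close> raises degrees by \<open>e' - e\<close>, so products
  with the monomials of \<open>p\<close> that are kept are kept on the right, and the other products
  are dropped. Writing the degrees as sums avoids truncated subtraction.\<close>

lemma part_mult_homogeneous:
  fixes p q :: "'a::semiring_0 mpoly"
  assumes "\<And>w. w \<in> keys q \<Longrightarrow> tdeg w + e = e'"
  shows "part (\<lambda>u. tdeg u + e' = d) p * q = part (\<lambda>u. tdeg u + e = d) (p * q)"
proof -
  let ?P = "\<lambda>u. tdeg u + e' = d" and ?Q = "\<lambda>u. tdeg u + e = d"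
  have p: "p = part ?P p + part (\<lambda>u. \<not> ?P u) p"
    by (rule poly_mapping_eqI) (simp add: lookup_part lookup_add)
  have "part ?Q (part ?P p * q) = part ?P p * q"
  proof (rule part_ident)
    fix u assume "u \<in> keys (part ?P p * q)"
    then obtain v w where "u = v + w" "?P v" "w \<in> keys q"
      using keys_mult[of "part ?P p" q] by (auto simp: keys_part)
    thus "?Q u"
      using assms[of w] by (simp add: tdeg_add add.assoc)
  qed
  moreover have "part ?Q (part (\<lambda>u. \<not> ?P u) p * q) = 0"
  proof (rule part_eq_0)
    fix u assume "u \<in> keys (part (\<lambda>u. \<not> ?P u) p * q)"
    then obtain v w where "u = v + w" "\<not> ?P v" "w \<in> keys q"
      using keys_mult[of "part (\<lambda>u. \<not> ?P u) p" q] by (auto simp: keys_part)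
    thus "\<not> ?Q u"
      using assms[of w] by (simp add: tdeg_add add.assoc)
  qed
  ultimately have "part ?Q ((part ?P p + part (\<lambda>u. \<not> ?P u) p) * q) = part ?P p * q"
    by (simp only: distrib_right part_add add_0_right)
  thus ?thesis
    by (simp only: p[symmetric])
qed

section \<open>Ideals of the polynomial ring\<close>

lemma polys_0 [simp]: "0 \<in> polys n" and polys_1 [simp]: "1 \<in> polys n"
  by (auto simp: polys_def monomials_def)

lemma polys_sum: "(\<And>i. i \<in> A \<Longrightarrow> f i \<in> polys n) \<Longrightarrow> sum f A \<in> polys n"
  using keys_sum by (fastforce simp: polys_def)

lemma polys_mult: "p \<in> polys n \<Longrightarrow> q \<in> polys n \<Longrightarrow> p * q \<in> polys n"
  using keys_mult[of p q] unfolding polys_def by (fastforce simp: monomials_add_iff)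

lemma polys_diff: "p \<in> polys n \<Longrightarrow> q \<in> polys n \<Longrightarrow> p - q \<in> polys n"
  using keys_diff[of p q] unfolding polys_def by fastforce

lemma polys_part: "p \<in> polys n \<Longrightarrow> part P p \<in> polys n"
  by (auto simp: polys_def keys_part)

lemma ideal_polys: "ideal (polys n) (poly_ring n)"
  using ring.oneideal[OF cring.axioms(1)[OF cring_poly_ring[of n]]] by (simp add: poly_ring_def)

context
  fixes n :: nat and I :: "'a::field mpoly set"
  assumes I: "ideal I (poly_ring n)"
begin

lemma ideal_0: "0 \<in> I"
  using additive_subgroup.zero_closed[OF ideal.axioms(1)[OF I]] by (simp add: poly_ring_def)

lemma ideal_add: "p \<in> I \<Longrightarrow> q \<in> I \<Longrightarrow> p + q \<in> I"
  using additive_subgroup.a_closed[OF ideal.axioms(1)[OF I]] by (simp add: poly_ring_def)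

lemma ideal_mult_right: "p \<in> I \<Longrightarrow> q \<in> polys n \<Longrightarrow> p * q \<in> I"
  using ideal.I_r_closed[OF I] by (simp add: poly_ring_def)

lemma ideal_sum: "(\<And>i. i \<in> A \<Longrightarrow> f i \<in> I) \<Longrightarrow> sum f A \<in> I"
  by (induction A rule: infinite_finite_induct) (simp_all add: ideal_0 ideal_add)

end

definition multiples :: "nat \<Rightarrow> monomial set \<Rightarrow> monomial set" where
  "multiples n M = {u \<in> monomials n. \<exists>m\<in>M. \<exists>w. u = m + w}"

text \<open>The polynomials supported on \<open>multiples n M\<close> form an ideal containing the
  generators, and each of their terms is a generator times a term. Membership thus depends only on
  the exponents that occur, so chains can be manipulated monomial by monomial.\<close>

lemma monomial_ideal_eq:
  assumes "M \<subseteq> monomials n"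
  shows "ideal (monomial_ideal n M :: 'a::field mpoly set) (poly_ring n)"
    and "monomial_ideal n M = {p :: 'a mpoly. keys p \<subseteq> multiples n M}"
proof -
  let ?J = "{p :: 'a mpoly. keys p \<subseteq> multiples n M}"
  interpret cring "poly_ring n :: 'a mpoly ring"
    by (rule cring_poly_ring)
  have gens: "mon ` M \<subseteq> carrier (poly_ring n :: 'a mpoly ring)"
    using assms by (auto simp: poly_ring_def polys_def mon_def)
  show ideal: "ideal (monomial_ideal n M :: 'a mpoly set) (poly_ring n)"
    unfolding monomial_ideal_def by (rule genideal_ideal[OF gens])
  have mult: "p * q \<in> ?J" if p: "p \<in> ?J" and q: "q \<in> polys n" for p q
  proof -
    have "u + w \<in> multiples n M" if "u \<in> keys p" "w \<in> keys q" for u w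
      using that p q by (fastforce simp: multiples_def polys_def monomials_add_iff add.assoc)
    with keys_mult[of p q] show ?thesis
      by blast
  qed
  have "ideal ?J (poly_ring n)"
  proof (rule idealI[OF ring_axioms add.subgroupI])
    show "?J \<subseteq> carrier (poly_ring n)"
      by (auto simp: poly_ring_def polys_def multiples_def)
    show "?J \<noteq> {}"
      by (auto intro!: exI[of _ 0])
    fix x assume x: "x \<in> ?J"
    have "\<ominus>\<^bsub>poly_ring n\<^esub> x = - x"
      using x by (intro minus_equality) (auto simp: poly_ring_def polys_def multiples_def)
    with x show "\<ominus>\<^bsub>poly_ring n\<^esub> x \<in> ?J"
      by simp
    show "x \<oplus>\<^bsub>poly_ring n\<^esub> y \<in> ?J" if "y \<in> ?J" for y
      using that x Poly_Mapping.keys_add[of x y] by (auto simp: poly_ring_def)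
  qed (use mult in \<open>auto simp: poly_ring_def mult.commute\<close>)
  moreover have "mon ` M \<subseteq> ?J"
    using assms by (force simp: mon_def multiples_def)
  ultimately have "monomial_ideal n M \<subseteq> ?J"
    unfolding monomial_ideal_def by (rule genideal_minimal)
  moreover have "?J \<subseteq> monomial_ideal n M"
  proof
    fix p assume p: "p \<in> ?J"
    have "single u c \<in> monomial_ideal n M" if u_mult: "u \<in> multiples n M"
      for u :: monomial and c :: 'a
    proof -
      obtain m w where u: "u = m + w" "m \<in> M"
        using u_mult by (auto simp: multiples_def)
      with u_mult have w: "w \<in> monomials n"
        by (simp add: multiples_def monomials_add_iff)
      have "mon m \<in> (monomial_ideal n M :: 'a mpoly set)"
        using genideal_self[OF gens] u by (auto simp: monomial_ideal_def)
      moreover have "single w c \<in> polys n"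
        using w by (simp add: polys_def)
      ultimately have "mon m * single w c \<in> (monomial_ideal n M :: 'a mpoly set)"
        by (rule ideal_mult_right[OF ideal])
      thus ?thesis
        by (simp add: mon_def mult_single u)
    qed
    hence "(\<Sum>u\<in>keys p. single u (lookup p u)) \<in> monomial_ideal n M"
      using p by (intro ideal_sum[OF ideal]) auto
    thus "p \<in> monomial_ideal n M"
      using poly_eq_sum_single[of p] by simp
  qed
  ultimately show "monomial_ideal n M = ?J"
    by blast
qed

section \<open>Graded maps of free modules\<close>

text \<open>The map of free modules of ranks \<open>r\<close> and \<open>s\<close> whose matrix has the rows \<open>A 0, A 1, \<dots>\<close>.\<close>

definition lin ::
    "nat \<Rightarrow> nat \<Rightarrow> (nat \<Rightarrow> nat \<Rightarrow> 'a::field mpoly) \<Rightarrow> (nat \<Rightarrow> 'a mpoly) \<Rightarrow> nat \<Rightarrow> 'a mpoly" where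
  "lin r s A v = (\<lambda>c. if c < s then \<Sum>b<r. v b * A b c else 0)"

lemma bdry_eq_lin: "bdry F i = lin (rk F (Suc i)) (rk F i) (coef F i)"
  by (simp add: bdry_def lin_def fun_eq_iff)

lemma lin_add: "lin r s A (v + w) = lin r s A v + lin r s A w"
  by (simp add: lin_def fun_eq_iff distrib_right sum.distrib)

lemma lin_diff: "lin r s A (v - w) = lin r s A v - lin r s A w"
  by (simp add: lin_def fun_eq_iff left_diff_distrib sum_subtractf)

lemma bdry_diff: "bdry F i (v - w) = bdry F i v - bdry F i w"
  by (simp add: bdry_eq_lin lin_diff)

lemma lin_0 [simp]: "lin r s A 0 = 0"
  by (simp add: lin_def fun_eq_iff)

lemma lin_cong:
  "(\<And>b c. b < r \<Longrightarrow> c < s \<Longrightarrow> A b c = B b c) \<Longrightarrow> lin r s A v = lin r s B v"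
  by (auto simp: lin_def fun_eq_iff intro!: sum.cong)

text \<open>Each row of a composite is the image of the corresponding row. Identities between maps
  can therefore be checked on rows, that is, on images of basis elements.\<close>

lemma lin_lin: "lin s t B (lin r s A v) = lin r t (\<lambda>b. lin s t B (A b)) v"
proof -
  have "(\<Sum>c<s. (\<Sum>b<r. v b * A b c) * B c e) = (\<Sum>b<r. v b * (\<Sum>c<s. A b c * B c e))" for e
    unfolding sum_distrib_left sum_distrib_right by (subst sum.swap) (simp add: mult.assoc)
  thus ?thesis
    by (simp add: lin_def fun_eq_iff)
qed

text \<open>As a function of \<open>b\<close> this is also the identity matrix.\<close>

definition unit_vec :: "nat \<Rightarrow> nat \<Rightarrow> 'a::field mpoly" where
  "unit_vec b = (\<lambda>c. if c = b then 1 else 0)"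

lemma lin_unit_vec: "b < r \<Longrightarrow> lin r s A (unit_vec b) = (\<lambda>c. if c < s then A b c else 0)"
proof -
  assume b: "b < r"
  have "(\<Sum>b'<r. (if b' = b then 1 else 0) * A b' c) = (\<Sum>b'<r. if b' = b then A b' c else 0)" for c
    by (rule sum.cong) auto
  with b show ?thesis
    by (simp add: lin_def unit_vec_def fun_eq_iff)
qed

lemma lin_unit_matrix: "(\<And>c. c \<ge> r \<Longrightarrow> v c = 0) \<Longrightarrow> lin r r unit_vec v = v"
proof -
  assume v: "\<And>c. c \<ge> r \<Longrightarrow> v c = 0"
  have "(\<Sum>b<r. v b * (if c = b then 1 else 0)) = (\<Sum>b<r. if c = b then v b else 0)" for c
    by (rule sum.cong) auto
  with v show ?thesis
    by (auto simp: lin_def unit_vec_def fun_eq_iff)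
qed

text \<open>The matrix has entries in S, and multiplication by them preserves an ideal. So a graded
  map between free modules induces a graded map after tensoring with \<open>I\<close>; the case
  \<open>I = polys n\<close> is the map itself.\<close>

lemma lin_chains_deg:
  assumes I: "ideal I (poly_ring n)"
    and A: "\<And>b. b < rk F i \<Longrightarrow> A b \<in> chains_deg G (polys n) k (gdeg F i b)"
    and v: "v \<in> chains_deg F I i d"
  shows "lin (rk F i) (rk G k) A v \<in> chains_deg G I k d"
proof -
  have "(\<Sum>b<rk F i. v b * A b c) \<in> I" if "c < rk G k" for c
    using v A that
    by (intro ideal_sum[OF I] ideal_mult_right[OF I]) (auto simp: chains_deg_def chains_def)
  moreover have "tdeg u + gdeg G k c = d"
    if c: "c < rk G k" and u: "u \<in> keys (\<Sum>b<rk F i. v b * A b c)" for c u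
  proof -
    obtain b where b: "b < rk F i" "u \<in> keys (v b * A b c)"
      using u keys_sum[of "\<lambda>b. v b * A b c" "{..<rk F i}"] by auto
    then obtain w w' where "u = w + w'" "w \<in> keys (v b)" "w' \<in> keys (A b c)"
      using keys_mult[of "v b" "A b c"] by blast
    moreover from this have "tdeg w + gdeg F i b = d" "tdeg w' + gdeg G k c = gdeg F i b"
      using b v A[OF b(1)] c by (auto simp: chains_deg_def)
    ultimately show ?thesis
      by (simp add: tdeg_add)
  qed
  ultimately show ?thesis
    by (simp add: lin_def chains_deg_def chains_def)
qed

lemma chains_deg_add:
  assumes I: "ideal I (poly_ring n)" and "v \<in> chains_deg F I i d" "w \<in> chains_deg F I i d"
  shows "v + w \<in> chains_deg F I i d"
  using assms(2,3) Poly_Mapping.keys_add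
  by (fastforce simp: chains_deg_def chains_def intro: ideal_add[OF I])

lemma chains_deg_diff:
  assumes "v \<in> chains_deg F (polys n) i d" "w \<in> chains_deg F (polys n) i d"
  shows "v - w \<in> chains_deg F (polys n) i d"
  using assms keys_diff by (fastforce simp: chains_deg_def chains_def intro: polys_diff)

lemma chains_deg_subset: "v \<in> chains_deg F I i d \<Longrightarrow> v \<in> chains F I i"
  by (simp add: chains_deg_def)

lemma zero_chains_deg: "ideal I (poly_ring n) \<Longrightarrow> 0 \<in> chains_deg F I i d"
  by (simp add: chains_deg_def chains_def ideal_0)

lemma unit_vec_chains_deg: "b < rk F i \<Longrightarrow> unit_vec b \<in> chains_deg F (polys n) i (gdeg F i b)"
  by (auto simp: unit_vec_def chains_deg_def chains_def)

section \<open>Comparison of resolutions\<close>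

text \<open>The content of \<open>resolves_field\<close> with the augmentation as a parameter,
  because comparison maps have to be compatible with it.\<close>

locale resolution =
  fixes n :: nat and F :: "'a::field free_complex" and a :: "nat \<Rightarrow> 'a"
  assumes coef_polys: "\<lbrakk>b < rk F (Suc i); c < rk F i\<rbrakk> \<Longrightarrow> coef F i b c \<in> polys n"
    and coef_degree: "\<lbrakk>b < rk F (Suc i); c < rk F i; u \<in> keys (coef F i b c)\<rbrakk>
      \<Longrightarrow> tdeg u + gdeg F i c = gdeg F (Suc i) b"
    and exact_Suc: "{v \<in> chains F (polys n) (Suc i). bdry F i v = 0} =
      bdry F (Suc i) ` chains F (polys n) (Suc (Suc i))"
    and augm_degree: "\<lbrakk>b < rk F 0; a b \<noteq> 0\<rbrakk> \<Longrightarrow> gdeg F 0 b = 0"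
    and augm_surj: "augm F a ` chains F (polys n) 0 = UNIV"
    and exact_0: "{v \<in> chains F (polys n) 0. augm F a v = 0} =
      bdry F 0 ` chains F (polys n) (Suc 0)"

lemma resolves_field_iff_resolution: "resolves_field n F \<longleftrightarrow> (\<exists>a. resolution n F a)"
proof
  assume "resolves_field n F"
  thus "\<exists>a. resolution n F a"
    unfolding resolves_field_def by (elim conjE exE, rule_tac x = a in exI, unfold_locales) simp_all
next
  assume "\<exists>a. resolution n F a"
  then obtain a where a: "resolution n F a" ..
  show "resolves_field n F"
    unfolding resolves_field_def
    by (intro conjI exI[of _ a] allI impI ballI)
      (simp_all add: resolution.coef_polys[OF a] resolution.coef_degree[OF a]
        resolution.exact_Suc[OF a] resolution.augm_degree[OF a] resolution.augm_surj[OF a]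
        resolution.exact_0[OF a])
qed

section \<open>Exactness in a fixed internal degree\<close>

context resolution
begin

text \<open>In degree 0 the augmentation takes the place of the differential, so that exactness
  reads the same in all degrees. This differs from \<open>tor_cycles\<close>, which imposes no
  condition there.\<close>

definition is_cycle :: "nat \<Rightarrow> (nat \<Rightarrow> 'a mpoly) \<Rightarrow> bool" where
  "is_cycle i v \<longleftrightarrow> (case i of 0 \<Rightarrow> augm F a v = 0 | Suc k \<Rightarrow> bdry F k v = 0)"

lemma is_cycle_iff_boundary:
  "v \<in> chains F (polys n) i \<and> is_cycle i v \<longleftrightarrow> v \<in> bdry F i ` chains F (polys n) (Suc i)"
proof (cases i)
  case 0
  with exact_0 show ?thesis
    by (auto simp: is_cycle_def)
next
  case (Suc k)
  with exact_Suc[of k] show ?thesis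
    by (auto simp: is_cycle_def)
qed

text \<open>Nothing is known about \<open>coef F i b c\<close> beyond the rank; padding by 0 makes
  the row a chain.\<close>

definition row :: "nat \<Rightarrow> nat \<Rightarrow> nat \<Rightarrow> 'a mpoly" where
  "row i b = (\<lambda>c. if c < rk F i then coef F i b c else 0)"

lemma row_chains_deg: "b < rk F (Suc i) \<Longrightarrow> row i b \<in> chains_deg F (polys n) i (gdeg F (Suc i) b)"
  using coef_polys coef_degree by (auto simp: row_def chains_deg_def chains_def)

lemma row_eq_bdry: "b < rk F (Suc i) \<Longrightarrow> row i b = bdry F i (unit_vec b)"
  by (simp add: bdry_eq_lin lin_unit_vec row_def)

lemma bdry_eq_lin_row: "bdry F i = lin (rk F (Suc i)) (rk F i) (row i)"
  by (rule ext) (auto simp: bdry_eq_lin row_def intro: lin_cong)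

lemma row_is_cycle: "b < rk F (Suc i) \<Longrightarrow> is_cycle i (row i b)"
  using is_cycle_iff_boundary[of "row i b" i] row_eq_bdry[of b i]
    chains_deg_subset[OF unit_vec_chains_deg[of b F "Suc i" n]] by auto

lemma bdry_chains_deg:
  "ideal I (poly_ring n) \<Longrightarrow> v \<in> chains_deg F I (Suc i) d \<Longrightarrow> bdry F i v \<in> chains_deg F I i d"
  unfolding bdry_eq_lin_row by (rule lin_chains_deg[where n = n]) (auto intro: row_chains_deg)

text \<open>A row is the boundary of a basis vector and hence a cycle by exactness. Linearity in the
  rows extends this to every \<open>v\<close>, in particular to chains with coefficients in an
  ideal.\<close>

lemma bdry_bdry: "bdry F i (bdry F (Suc i) v) = 0"
proof -
  have "bdry F i (row (Suc i) b) = 0" if "b < rk F (Suc (Suc i))" for b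
    using row_is_cycle[OF that] by (simp add: is_cycle_def)
  hence "lin (rk F (Suc (Suc i))) (rk F i) (\<lambda>b. bdry F i (row (Suc i) b)) v =
      lin (rk F (Suc (Suc i))) (rk F i) (\<lambda>_ _. 0) v"
    by (intro lin_cong) simp
  thus ?thesis
    unfolding bdry_eq_lin_row lin_lin by (simp add: lin_def fun_eq_iff)
qed

lemma tor_boundaries_subset:
  assumes "ideal I (poly_ring n)"
  shows "tor_boundaries F I i d \<subseteq> tor_cycles F I i d"
  using bdry_chains_deg[OF assms] bdry_bdry
  by (auto simp: tor_boundaries_def tor_cycles_def split: nat.split)

lemma bdry_part:
  "c < rk F i \<Longrightarrow> bdry F i (\<lambda>b. if b < rk F (Suc i)
      then part (\<lambda>u. tdeg u + gdeg F (Suc i) b = d) (v b) else 0) c =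
    part (\<lambda>u. tdeg u + gdeg F i c = d) (bdry F i v c)"
  by (simp add: bdry_def part_sum) (auto intro!: sum.cong part_mult_homogeneous coef_degree)

text \<open>Exactness supplies a preimage of no particular degree. The differential is homogeneous,
  so the component of degree \<open>d\<close> of that preimage is mapped to the component of degree
  \<open>d\<close> of \<open>v\<close>, which is \<open>v\<close>.\<close>

lemma cycle_deg_imp_boundary:
  assumes v: "v \<in> chains_deg F (polys n) i d" and "is_cycle i v"
  obtains w where "w \<in> chains_deg F (polys n) (Suc i) d" "bdry F i w = v"
proof -
  obtain w where w: "w \<in> chains F (polys n) (Suc i)" "v = bdry F i w"
    using assms is_cycle_iff_boundary[of v i] by (auto simp: chains_deg_def)
  let ?w = "\<lambda>b. if b < rk F (Suc i) then part (\<lambda>u. tdeg u + gdeg F (Suc i) b = d) (w b) else 0"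
  have "?w \<in> chains_deg F (polys n) (Suc i) d"
    using w(1) by (auto simp: chains_deg_def chains_def polys_part keys_part)
  moreover have "bdry F i ?w c = v c" for c
  proof (cases "c < rk F i")
    case True
    thus ?thesis
      using v by (simp add: bdry_part w(2)[symmetric] part_ident chains_deg_def)
  next
    case False
    thus ?thesis
      by (simp add: w(2) bdry_def)
  qed
  ultimately show ?thesis
    using that by blast
qed

text \<open>K sits in degree 0, whence the hypothesis. Truncating a preimage to degree 0 does not
  change its augmentation, because \<open>a\<close> vanishes on basis elements of any other
  degree.\<close>

lemma augm_lift:
  assumes "t \<noteq> 0 \<Longrightarrow> d = 0"
  obtains w where "w \<in> chains_deg F (polys n) 0 d" "augm F a w = t"
proof (cases "t = 0")
  case True
  have "augm F a 0 = t"
    by (simp add: augm_def True)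
  with zero_chains_deg[OF ideal_polys] show ?thesis
    using that by blast
next
  case False
  obtain w where w: "w \<in> chains F (polys n) 0" "augm F a w = t"
    using augm_surj by (metis UNIV_I imageE)
  let ?w = "\<lambda>b. if b < rk F 0 then part (\<lambda>u. tdeg u + gdeg F 0 b = 0) (w b) else 0"
  have "?w \<in> chains_deg F (polys n) 0 d"
    using w(1) assms False by (auto simp: chains_deg_def chains_def polys_part keys_part)
  moreover have "augm F a ?w = t"
    unfolding w(2)[symmetric] augm_def
    by (rule sum.cong) (use augm_degree in \<open>fastforce simp: lookup_part\<close>)+
  ultimately show ?thesis
    using that by blast
qed

lemma augm_lin:
  "augm F a (lin r (rk F 0) A v) = (\<Sum>b<r. lookup (v b) 0 * augm F a (A b))"
  unfolding augm_def lin_def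
  by (simp add: lookup_sum lookup_0_mult sum_distrib_left sum_distrib_right mult.assoc)
    (rule sum.swap)

end

text \<open>Comparison theorem, existence of a lift of the identity of K: the images of the basis
  elements are chosen degree by degree, using exactness of \<open>G\<close>. The rows
  \<open>f i b\<close> are homogeneous, so the map is graded.\<close>

lemma chain_map_exists:
  fixes F G :: "'a::field free_complex"
  assumes "resolution n F a" "resolution n G e"
  obtains f where "\<And>i b. b < rk F i \<Longrightarrow> f i b \<in> chains_deg G (polys n) i (gdeg F i b)"
    and "\<And>b. b < rk F 0 \<Longrightarrow> augm G e (f 0 b) = a b"
    and "\<And>i v. bdry G i (lin (rk F (Suc i)) (rk G (Suc i)) (f (Suc i)) v) =
      lin (rk F i) (rk G i) (f i) (bdry F i v)"
proof -
  interpret F: resolution n F a by fact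
  interpret G: resolution n G e by fact
  \<comment> \<open>The second conjunct sends the rows of the differential of \<open>F\<close>,
    which are cycles, to cycles of \<open>G\<close>, which can then be lifted. It is inherited from
    one degree to the next through \<open>Q\<close>.\<close>
  define P where "P = (\<lambda>i f. (\<forall>b<rk F i. f b \<in> chains_deg G (polys n) i (gdeg F i b)) \<and>
    (\<forall>v. F.is_cycle i v \<longrightarrow> G.is_cycle i (lin (rk F i) (rk G i) f v)))"
  define Q where "Q = (\<lambda>i f f'. \<forall>b<rk F (Suc i).
    bdry G i (f' b) = lin (rk F i) (rk G i) f (F.row i b))"
  have Q: "bdry G i (lin (rk F (Suc i)) (rk G (Suc i)) f' v) = lin (rk F i) (rk G i) f (bdry F i v)"
    if "Q i f f'" for i f f' v
  proof -
    have "bdry G i (lin (rk F (Suc i)) (rk G (Suc i)) f' v) =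
        lin (rk F (Suc i)) (rk G i) (\<lambda>b. bdry G i (f' b)) v"
      by (simp only: bdry_eq_lin lin_lin)
    also have "\<dots> = lin (rk F (Suc i)) (rk G i) (\<lambda>b. lin (rk F i) (rk G i) f (F.row i b)) v"
      using that by (intro lin_cong) (simp add: Q_def)
    finally show ?thesis
      by (simp only: F.bdry_eq_lin_row lin_lin)
  qed
  have "\<exists>w. w \<in> chains_deg G (polys n) 0 (gdeg F 0 b) \<and> augm G e w = a b" if "b < rk F 0" for b
    using G.augm_lift[OF F.augm_degree[OF that]] by blast
  then obtain f0 where f0: "\<And>b. b < rk F 0 \<Longrightarrow> f0 b \<in> chains_deg G (polys n) 0 (gdeg F 0 b)"
    "\<And>b. b < rk F 0 \<Longrightarrow> augm G e (f0 b) = a b"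
    by metis
  have "augm G e (lin (rk F 0) (rk G 0) f0 v) = augm F a v" for v
    by (simp add: G.augm_lin f0) (simp add: augm_def)
  hence P0: "P 0 f0"
    by (simp add: P_def f0 F.is_cycle_def G.is_cycle_def)
  have step: "\<exists>f'. P (Suc i) f' \<and> Q i f f'" if P: "P i f" for i f
  proof -
    have "\<exists>w. w \<in> chains_deg G (polys n) (Suc i) (gdeg F (Suc i) b) \<and>
        bdry G i w = lin (rk F i) (rk G i) f (F.row i b)" if b: "b < rk F (Suc i)" for b
    proof -
      have "lin (rk F i) (rk G i) f (F.row i b) \<in> chains_deg G (polys n) i (gdeg F (Suc i) b)"
        using P F.row_chains_deg[OF b] by (intro lin_chains_deg[OF ideal_polys]) (auto simp: P_def)
      moreover have "G.is_cycle i (lin (rk F i) (rk G i) f (F.row i b))"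
        using P F.row_is_cycle[OF b] by (simp add: P_def)
      ultimately show ?thesis
        using G.cycle_deg_imp_boundary by blast
    qed
    then obtain f' where f': "\<And>b. b < rk F (Suc i) \<Longrightarrow>
        f' b \<in> chains_deg G (polys n) (Suc i) (gdeg F (Suc i) b)" "Q i f f'"
      unfolding Q_def by metis
    moreover from this have "P (Suc i) f'"
      by (simp add: P_def F.is_cycle_def G.is_cycle_def Q)
    ultimately show ?thesis
      by blast
  qed
  have "\<exists>f. f 0 = f0 \<and> (\<forall>i. P i (f i) \<and> Q i (f i) (f (Suc i)))"
  proof -
    \<comment> \<open>The start \<open>f0\<close> is built into the invariant, because the
      compatibility with the augmentations is known for \<open>f0\<close> only.\<close>
    have "\<exists>f. \<forall>i. (P i (f i) \<and> (i = 0 \<longrightarrow> f i = f0)) \<and> Q i (f i) (f (Suc i))"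
      by (rule dependent_nat_choice) (use P0 step in auto)
    thus ?thesis
      by blast
  qed
  then obtain f where f: "f 0 = f0" "\<And>i. P i (f i)" "\<And>i. Q i (f i) (f (Suc i))"
    by blast
  show ?thesis
  proof (rule that[of f])
    show "f i b \<in> chains_deg G (polys n) i (gdeg F i b)" if "b < rk F i" for i b
      using f(2)[of i] that by (simp add: P_def)
    show "augm G e (f 0 b) = a b" if "b < rk F 0" for b
      using that f0(2) f(1) by simp
    show "bdry G i (lin (rk F (Suc i)) (rk G (Suc i)) (f (Suc i)) v) =
        lin (rk F i) (rk G i) (f i) (bdry F i v)" for i v
      using Q[OF f(3)] .
  qed
qed

text \<open>Comparison theorem, uniqueness up to homotopy: a graded chain map that induces 0 on K is
  null-homotopic. It is applied to the difference of the identity and a round trip between two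
  resolutions.\<close>

lemma (in resolution) null_homotopy_exists:
  assumes g: "\<And>i b. b < rk F i \<Longrightarrow> g i b \<in> chains_deg F (polys n) i (gdeg F i b)"
    and augm_g: "\<And>b. b < rk F 0 \<Longrightarrow> augm F a (g 0 b) = 0"
    and chain_map: "\<And>i v. bdry F i (lin (rk F (Suc i)) (rk F (Suc i)) (g (Suc i)) v) =
      lin (rk F i) (rk F i) (g i) (bdry F i v)"
  obtains h where "\<And>i b. b < rk F i \<Longrightarrow> h i b \<in> chains_deg F (polys n) (Suc i) (gdeg F i b)"
    and "\<And>v. lin (rk F 0) (rk F 0) (g 0) v = bdry F 0 (lin (rk F 0) (rk F 1) (h 0) v)"
    and "\<And>i v. lin (rk F (Suc i)) (rk F (Suc i)) (g (Suc i)) v =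
      bdry F (Suc i) (lin (rk F (Suc i)) (rk F (Suc (Suc i))) (h (Suc i)) v) +
      lin (rk F i) (rk F (Suc i)) (h i) (bdry F i v)"
proof -
  \<comment> \<open>The second conjunct is the homotopy identity on cycles, where the term with the
    differential drops out. The equation \<open>Q\<close> is the full identity on basis elements of
    the next degree.\<close>
  define P where "P = (\<lambda>i h. (\<forall>b<rk F i. h b \<in> chains_deg F (polys n) (Suc i) (gdeg F i b)) \<and>
    (\<forall>v. is_cycle i v \<longrightarrow>
      bdry F i (lin (rk F i) (rk F (Suc i)) h v) = lin (rk F i) (rk F i) (g i) v))"
  define Q where "Q = (\<lambda>i h h'. \<forall>b<rk F (Suc i).
    bdry F (Suc i) (h' b) = g (Suc i) b - lin (rk F i) (rk F (Suc i)) h (row i b))"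
  have bdry_lin: "bdry F i (lin r (rk F (Suc i)) h v) = lin r (rk F i) (\<lambda>b. bdry F i (h b)) v"
    for i r h v
    by (simp only: bdry_eq_lin lin_lin)
  have Q: "lin (rk F (Suc i)) (rk F (Suc i)) (g (Suc i)) v =
      bdry F (Suc i) (lin (rk F (Suc i)) (rk F (Suc (Suc i))) h' v) +
      lin (rk F i) (rk F (Suc i)) h (bdry F i v)" if "Q i h h'" for i h h' v
  proof -
    have "bdry F (Suc i) (lin (rk F (Suc i)) (rk F (Suc (Suc i))) h' v) =
        lin (rk F (Suc i)) (rk F (Suc i))
          (\<lambda>b. g (Suc i) b - lin (rk F i) (rk F (Suc i)) h (row i b)) v"
      unfolding bdry_lin using that by (intro lin_cong) (simp add: Q_def)
    also have "\<dots> = lin (rk F (Suc i)) (rk F (Suc i)) (g (Suc i)) v -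
        lin (rk F i) (rk F (Suc i)) h (bdry F i v)"
      unfolding bdry_eq_lin_row lin_lin
      by (simp add: lin_def fun_eq_iff right_diff_distrib sum_subtractf)
    finally show ?thesis
      by simp
  qed
  have "\<exists>w. w \<in> chains_deg F (polys n) (Suc 0) (gdeg F 0 b) \<and> bdry F 0 w = g 0 b"
    if b: "b < rk F 0" for b
    using cycle_deg_imp_boundary[OF g[OF b]] augm_g[OF b] by (auto simp: is_cycle_def)
  then obtain h0 where h0: "\<And>b. b < rk F 0 \<Longrightarrow> h0 b \<in> chains_deg F (polys n) (Suc 0) (gdeg F 0 b)"
    "\<And>b. b < rk F 0 \<Longrightarrow> bdry F 0 (h0 b) = g 0 b"
    by metis
  have h0_eq: "lin (rk F 0) (rk F 0) (g 0) v = bdry F 0 (lin (rk F 0) (rk F 1) h0 v)" for v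
    using bdry_lin[of 0 "rk F 0" h0 v] h0(2) by (auto intro!: lin_cong)
  hence P0: "P 0 h0"
    by (simp add: P_def h0)
  have step: "\<exists>h'. P (Suc i) h' \<and> Q i h h'" if P: "P i h" for i h
  proof -
    have "\<exists>w. w \<in> chains_deg F (polys n) (Suc (Suc i)) (gdeg F (Suc i) b) \<and>
        bdry F (Suc i) w = g (Suc i) b - lin (rk F i) (rk F (Suc i)) h (row i b)"
      if b: "b < rk F (Suc i)" for b
    proof -
      let ?z = "g (Suc i) b - lin (rk F i) (rk F (Suc i)) h (row i b)"
      have "lin (rk F i) (rk F (Suc i)) h (row i b) \<in>
          chains_deg F (polys n) (Suc i) (gdeg F (Suc i) b)"
        using P row_chains_deg[OF b] by (intro lin_chains_deg[OF ideal_polys]) (auto simp: P_def)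
      hence "?z \<in> chains_deg F (polys n) (Suc i) (gdeg F (Suc i) b)"
        using g[OF b] by (intro chains_deg_diff)
      \<comment> \<open>Both summands of \<open>?z\<close> have boundary
        \<open>lin (rk F i) (rk F i) (g i) (row i b)\<close>: the first because \<open>g\<close> is
        a chain map, the second by \<open>P\<close>, since the row is a cycle.\<close>
      moreover have "bdry F i ?z = 0"
      proof -
        have "g (Suc i) b = lin (rk F (Suc i)) (rk F (Suc i)) (g (Suc i)) (unit_vec b)"
          using g[OF b] b by (auto simp: lin_unit_vec chains_deg_def chains_def fun_eq_iff)
        hence "bdry F i (g (Suc i) b) = lin (rk F i) (rk F i) (g i) (row i b)"
          by (simp add: chain_map row_eq_bdry[OF b])
        moreover have "bdry F i (lin (rk F i) (rk F (Suc i)) h (row i b)) =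
            lin (rk F i) (rk F i) (g i) (row i b)"
          using P row_is_cycle[OF b] by (simp add: P_def)
        ultimately show ?thesis
          by (simp add: bdry_eq_lin lin_diff)
      qed
      ultimately show ?thesis
        using cycle_deg_imp_boundary[of ?z "Suc i"] by (auto simp: is_cycle_def)
    qed
    then obtain h' where h': "\<And>b. b < rk F (Suc i) \<Longrightarrow>
        h' b \<in> chains_deg F (polys n) (Suc (Suc i)) (gdeg F (Suc i) b)" "Q i h h'"
      unfolding Q_def by metis
    moreover from this have "P (Suc i) h'"
      using Q[OF h'(2)] by (simp add: P_def is_cycle_def)
    ultimately show ?thesis
      by blast
  qed
  have "\<exists>h. \<forall>i. (P i (h i) \<and> (i = 0 \<longrightarrow> h i = h0)) \<and> Q i (h i) (h (Suc i))"
    by (rule dependent_nat_choice) (use P0 step in auto)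
  then obtain h where h: "h 0 = h0" "\<And>i. P i (h i)" "\<And>i. Q i (h i) (h (Suc i))"
    by blast
  show ?thesis
  proof (rule that[of h])
    show "h i b \<in> chains_deg F (polys n) (Suc i) (gdeg F i b)" if "b < rk F i" for i b
      using h(2)[of i] that by (simp add: P_def)
  qed (use h0_eq h(1) Q[OF h(3)] in auto)
qed

text \<open>With chain maps \<open>f\<close>, \<open>g\<close> in both directions and a homotopy
  \<open>h\<close> from their composite to the identity, a cycle \<open>z\<close> whose image
  \<open>f z\<close> is the boundary of \<open>w\<close> is itself the boundary of
  \<open>h z + g w\<close>. All these maps have entries in S, so the argument takes place in
  coefficients from \<open>I\<close>.\<close>

lemma tor_vanishing_transfer:
  fixes F G :: "'a::field free_complex"
  assumes "resolution n F a" "resolution n G e" and I: "ideal I (poly_ring n)"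
    and G_vanish: "tor_cycles G I i d \<subseteq> tor_boundaries G I i d"
  shows "tor_cycles F I i d \<subseteq> tor_boundaries F I i d"
proof
  fix z assume z: "z \<in> tor_cycles F I i d"
  interpret F: resolution n F a by fact
  interpret G: resolution n G e by fact
  obtain f where f: "\<And>i b. b < rk F i \<Longrightarrow> f i b \<in> chains_deg G (polys n) i (gdeg F i b)"
    "\<And>b. b < rk F 0 \<Longrightarrow> augm G e (f 0 b) = a b"
    "\<And>i v. bdry G i (lin (rk F (Suc i)) (rk G (Suc i)) (f (Suc i)) v) =
      lin (rk F i) (rk G i) (f i) (bdry F i v)"
    using chain_map_exists[OF assms(1,2)] by blast
  obtain g where g: "\<And>i b. b < rk G i \<Longrightarrow> g i b \<in> chains_deg F (polys n) i (gdeg G i b)"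
    "\<And>b. b < rk G 0 \<Longrightarrow> augm F a (g 0 b) = e b"
    "\<And>i v. bdry F i (lin (rk G (Suc i)) (rk F (Suc i)) (g (Suc i)) v) =
      lin (rk G i) (rk F i) (g i) (bdry G i v)"
    using chain_map_exists[OF assms(2,1)] by blast
  \<comment> \<open>The rows of the identity minus the round trip through \<open>G\<close>; this map
    induces 0 on K.\<close>
  define t where "t = (\<lambda>i b. unit_vec b - lin (rk G i) (rk F i) (g i) (f i b))"
  have t_eq: "lin (rk F i) (rk F i) (t i) v =
      v - lin (rk G i) (rk F i) (g i) (lin (rk F i) (rk G i) (f i) v)"
    if "\<And>b. b \<ge> rk F i \<Longrightarrow> v b = 0" for i v
  proof -
    have "lin (rk F i) (rk F i) (t i) v = lin (rk F i) (rk F i) unit_vec v -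
        lin (rk F i) (rk F i) (\<lambda>b. lin (rk G i) (rk F i) (g i) (f i b)) v"
      by (simp add: t_def lin_def fun_eq_iff right_diff_distrib sum_subtractf)
    thus ?thesis
      by (simp add: lin_unit_matrix that lin_lin)
  qed
  have t_deg: "t i b \<in> chains_deg F (polys n) i (gdeg F i b)" if "b < rk F i" for i b
    unfolding t_def using that f(1) g(1)
    by (intro chains_deg_diff unit_vec_chains_deg lin_chains_deg[OF ideal_polys]) auto
  have "augm F a (t 0 b) = 0" if b: "b < rk F 0" for b
  proof -
    have "augm F a (lin (rk G 0) (rk F 0) (g 0) (f 0 b)) = augm G e (f 0 b)"
      by (simp add: F.augm_lin g(2)) (simp add: augm_def)
    moreover have "augm F a (unit_vec b) = a b"
    proof -
      have "augm F a (unit_vec b) = (\<Sum>c<rk F 0. if c = b then a c else 0)"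
        unfolding augm_def unit_vec_def by (rule sum.cong) auto
      with b show ?thesis by simp
    qed
    ultimately show ?thesis
      using f(2)[OF b] by (simp add: t_def augm_def lookup_minus left_diff_distrib sum_subtractf)
  qed
  moreover have "bdry F i (lin (rk F (Suc i)) (rk F (Suc i)) (t (Suc i)) v) =
      lin (rk F i) (rk F i) (t i) (bdry F i v)" for i v
  proof -
    \<comment> \<open>The identity matrix fixes only padded vectors, so \<open>v\<close> is first
      cut off at the rank, which \<open>lin\<close> does not notice.\<close>
    define v' where "v' = (\<lambda>b. if b < rk F (Suc i) then v b else 0)"
    have v': "lin (rk F (Suc i)) s A v' = lin (rk F (Suc i)) s A v" for s A
      by (auto simp: lin_def v'_def)
    have "bdry F i (lin (rk F (Suc i)) (rk F (Suc i)) (t (Suc i)) v') =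
        lin (rk F i) (rk F i) (t i) (bdry F i v')"
    proof -
      let ?w = "lin (rk F (Suc i)) (rk G (Suc i)) (f (Suc i)) v'"
      have "bdry F i (v' - lin (rk G (Suc i)) (rk F (Suc i)) (g (Suc i)) ?w) =
          bdry F i v' - lin (rk G i) (rk F i) (g i) (lin (rk F i) (rk G i) (f i) (bdry F i v'))"
        by (simp only: bdry_diff f(3) g(3))
      moreover have "bdry F i v' b = 0" if "b \<ge> rk F i" for b
        using that by (simp add: bdry_def)
      ultimately show ?thesis
        using t_eq[of i "bdry F i v'"] t_eq[of "Suc i" v'] by (simp add: v'_def)
    qed
    thus ?thesis
      by (simp add: bdry_eq_lin v')
  qed
  ultimately obtain h where
    h: "\<And>i b. b < rk F i \<Longrightarrow> h i b \<in> chains_deg F (polys n) (Suc i) (gdeg F i b)"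
    "\<And>v. lin (rk F 0) (rk F 0) (t 0) v = bdry F 0 (lin (rk F 0) (rk F 1) (h 0) v)"
    "\<And>i v. lin (rk F (Suc i)) (rk F (Suc i)) (t (Suc i)) v =
      bdry F (Suc i) (lin (rk F (Suc i)) (rk F (Suc (Suc i))) (h (Suc i)) v) +
      lin (rk F i) (rk F (Suc i)) (h i) (bdry F i v)"
    using F.null_homotopy_exists[OF t_deg] by blast
  have zc: "z \<in> chains_deg F I i d"
    using z by (simp add: tor_cycles_def)
  let ?fz = "lin (rk F i) (rk G i) (f i) z" and ?hz = "lin (rk F i) (rk F (Suc i)) (h i) z"
  have "?fz \<in> chains_deg G I i d"
    using zc f(1) by (intro lin_chains_deg[OF I])
  moreover have "bdry G k ?fz = 0" if "i = Suc k" for k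
    using z that f(3)[of k z] by (simp add: tor_cycles_def)
  ultimately have "?fz \<in> tor_cycles G I i d"
    by (auto simp: tor_cycles_def split: nat.split)
  then obtain w where w: "w \<in> chains_deg G I (Suc i) d" "?fz = bdry G i w"
    using G_vanish by (auto simp: tor_boundaries_def)
  let ?gw = "lin (rk G (Suc i)) (rk F (Suc i)) (g (Suc i)) w"
  \<comment> \<open>The homotopy term containing the boundary of \<open>z\<close> vanishes because
    \<open>z\<close> is a cycle; in degree 0 there is no such term.\<close>
  have "lin (rk F i) (rk F i) (t i) z = bdry F i ?hz"
    using z h(2) h(3)[of _ z] by (cases i) (auto simp: tor_cycles_def)
  moreover have "lin (rk F i) (rk F i) (t i) z = z - bdry F i ?gw"
    using zc t_eq[of i z] by (simp add: chains_deg_def chains_def w(2) g(3))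
  ultimately have "z = bdry F i (?hz + ?gw)"
    by (simp add: bdry_eq_lin lin_add algebra_simps)
  moreover have "?hz + ?gw \<in> chains_deg F I (Suc i) d"
    using zc w(1) h(1) g(1) by (intro chains_deg_add[OF I] lin_chains_deg[OF I])
  ultimately show "z \<in> tor_boundaries F I i d"
    by (auto simp: tor_boundaries_def)
qed

section \<open>The Koszul complex\<close>

text \<open>The simplifier would turn the exponent in \<^term>\<open>var j\<close> into \<^term>\<open>Suc 0\<close>.\<close>

declare One_nat_def [simp del]

text \<open>For \<open>j\<close> outside \<open>A\<close>, the sign acquired in the exterior algebra
  by moving \<open>e_j\<close> from the front of \<open>e_j e_A\<close> to its place in increasing
  order.\<close>

definition ksign :: "nat \<Rightarrow> nat set \<Rightarrow> 'a::comm_ring_1" where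
  "ksign j A = (-1) ^ card {i \<in> A. i < j}"

lemma ksign_square [simp]: "ksign j A * (ksign j A * c) = c"
  by (simp add: ksign_def mult.assoc[symmetric] power_add[symmetric])

lemma ksign_insert:
  assumes "finite A" "j \<notin> A"
  shows "ksign k (insert j A) = (if j < k then - ksign k A else ksign k A)"
proof -
  have "{i \<in> insert j A. i < k} = (if j < k then insert j {i \<in> A. i < k} else {i \<in> A. i < k})"
    by auto
  with assms show ?thesis
    by (simp add: ksign_def)
qed

text \<open>Exactly one of \<open>j\<close> and \<open>k\<close> is the smaller one, so exactly one
  of the two insertions changes a sign. This is the anticommutativity behind the differential
  squaring to zero.\<close>

lemma ksign_swap:
  assumes "finite A" "j \<notin> A" "k \<notin> A" "j \<noteq> k"
  shows "ksign k (insert j A) * ksign j A = - (ksign j (insert k A) * ksign k A)"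
  using assms by (auto simp: ksign_insert mult.commute)

text \<open>The augmented chain complex of the simplex with vertex set \<open>V\<close>, and the contraction of it to
  the vertex \<open>j\<close>, both acting on coefficient functions.\<close>

definition simplex_diff :: "nat set \<Rightarrow> (nat set \<Rightarrow> 'a::comm_ring_1) \<Rightarrow> nat set \<Rightarrow> 'a" where
  "simplex_diff V f A = (\<Sum>k\<in>V - A. ksign k A * f (insert k A))"

definition simplex_cone :: "nat \<Rightarrow> (nat set \<Rightarrow> 'a::comm_ring_1) \<Rightarrow> nat set \<Rightarrow> 'a" where
  "simplex_cone j f A = (if j \<in> A then ksign j (A - {j}) * f (A - {j}) else 0)"

text \<open>If \<open>j\<close> is not in \<open>A\<close>, only the term inserting \<open>j\<close>
  survives. If \<open>j\<close> is in \<open>A\<close>, the terms inserting another vertex cancel by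
  the sign rule, and removing and reinserting \<open>j\<close> yields \<open>f A\<close>.\<close>

lemma simplex_homotopy:
  assumes "finite V" "j \<in> V" "A \<subseteq> V"
  shows "simplex_diff V (simplex_cone j f) A + simplex_cone j (simplex_diff V f) A = f A"
proof (cases "j \<in> A")
  case False
  have "simplex_diff V (simplex_cone j f) A =
      (\<Sum>k\<in>V - A. if k = j then ksign j A * (ksign j A * f A) else 0)"
    unfolding simplex_diff_def using False by (intro sum.cong) (auto simp: simplex_cone_def)
  with False assms show ?thesis
    by (simp add: simplex_cone_def)
next
  case True
  define B where "B = A - {j}"
  have A: "A = insert j B" "j \<notin> B" "finite B"
    using True assms finite_subset[of A V] by (auto simp: B_def)
  have V: "V - B = insert j (V - A)"
    using assms A by auto
  have "simplex_diff V (simplex_cone j f) A = (\<Sum>k\<in>V - A. - (ksign j B * (ksign k B * f (insert k B))))"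
    unfolding simplex_diff_def
  proof (rule sum.cong)
    fix k assume k: "k \<in> V - A"
    hence "insert k A - {j} = insert k B"
      using A by auto
    hence "ksign k A * simplex_cone j f (insert k A) =
        (ksign k (insert j B) * ksign j (insert k B)) * f (insert k B)"
      by (simp add: simplex_cone_def A mult.assoc)
    also have "ksign k (insert j B) * ksign j (insert k B) = - (ksign j B * ksign k B :: 'a)"
      using k A by (auto simp: ksign_insert mult.commute)
    finally show "ksign k A * simplex_cone j f (insert k A) = - (ksign j B * (ksign k B * f (insert k B)))"
      by (simp add: mult.assoc)
  qed simp
  moreover have "simplex_cone j (simplex_diff V f) A =
      f A + (\<Sum>k\<in>V - A. ksign j B * (ksign k B * f (insert k B)))"
  proof -
    have "simplex_cone j (simplex_diff V f) A =
        ksign j B * (\<Sum>k\<in>insert j (V - A). ksign k B * f (insert k B))"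
      using True by (simp only: simplex_cone_def B_def[symmetric] simplex_diff_def V if_True)
    also have "\<dots> = ksign j B * (ksign j B * f A + (\<Sum>k\<in>V - A. ksign k B * f (insert k B)))"
      using assms(1) True A(1) by (subst sum.insert) auto
    finally show ?thesis
      by (simp only: distrib_left sum_distrib_left ksign_square)
  qed
  ultimately show ?thesis
    by (simp add: sum_negf)
qed

section \<open>Squarefree monomials, the multidegrees of the Koszul basis elements\<close>

definition sqf_mon :: "nat set \<Rightarrow> monomial" where
  "sqf_mon A = (\<Sum>i\<in>A. var i)"

lemma lookup_sqf_mon: "finite A \<Longrightarrow> lookup (sqf_mon A) i = (if i \<in> A then 1 else 0)"
  by (simp add: sqf_mon_def lookup_sum lookup_single when_def)

lemma keys_sqf_mon: "finite A \<Longrightarrow> keys (sqf_mon A) = A"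
  by (auto simp: in_keys_iff lookup_sqf_mon split: if_splits)

lemma tdeg_sqf_mon: "finite A \<Longrightarrow> tdeg (sqf_mon A) = card A"
  by (simp add: tdeg_def keys_sqf_mon lookup_sqf_mon)

lemma minus_sqf_mon_add:
  assumes "finite A" "A \<subseteq> keys u"
  shows "u - sqf_mon A + sqf_mon A = u"
proof (rule poly_mapping_eqI)
  show "lookup (u - sqf_mon A + sqf_mon A) i = lookup u i" for i
    using assms by (cases "i \<in> A") (auto simp: lookup_add lookup_minus lookup_sqf_mon in_keys_iff)
qed

lemma minus_sqf_mon_add_var:
  assumes "finite A" "A \<subseteq> keys u" "j \<in> A"
  shows "u - sqf_mon A + var j = u - sqf_mon (A - {j})"
proof (rule poly_mapping_eqI)
  show "lookup (u - sqf_mon A + var j) i = lookup (u - sqf_mon (A - {j})) i" for i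
    using assms
    by (cases "i = j") (auto simp: lookup_add lookup_minus lookup_sqf_mon lookup_single in_keys_iff)
qed

lemma add_minus_sqf_mon_insert:
  assumes "finite A" "j \<notin> A"
  shows "u + sqf_mon A - sqf_mon (insert j A) = u - var j"
proof (rule poly_mapping_eqI)
  show "lookup (u + sqf_mon A - sqf_mon (insert j A)) i = lookup (u - var j) i" for i
    using assms
    by (cases "i = j") (auto simp: lookup_add lookup_minus lookup_sqf_mon lookup_single)
qed

lemma sqf_mon_remove: "finite A \<Longrightarrow> j \<in> A \<Longrightarrow> var j + sqf_mon (A - {j}) = sqf_mon A"
  by (simp add: sqf_mon_def sum.remove)

definition subsets :: "nat \<Rightarrow> nat \<Rightarrow> nat set set" where
  "subsets n i = {A. A \<subseteq> {1..n} \<and> card A = i}"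

lemma finite_subsets: "finite (subsets n i)"
  by (simp add: subsets_def)

lemma finite_of_subsets: "A \<in> subsets n i \<Longrightarrow> finite A"
  by (auto simp: subsets_def intro: finite_subset)

text \<open>The chain \<open>\<Sum>\<^sub>A w A e\<^sub>A\<close> of the Koszul complex is identified with its coefficient function \<open>w\<close>,
  defined on all sets and zero outside the relevant ones.\<close>

definition kdiff :: "nat \<Rightarrow> (nat set \<Rightarrow> 'a::comm_ring_1 mpoly) \<Rightarrow> nat set \<Rightarrow> 'a mpoly" where
  "kdiff n w A = (\<Sum>j\<in>{1..n} - A. w (insert j A) * single (var j) (ksign j A))"

text \<open>Inserting \<open>j\<close> and \<open>k\<close> in either order reaches the same
  coefficient of \<open>w\<close> with the same monomial but opposite signs.\<close>

lemma kdiff_kdiff: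
  assumes "finite A"
  shows "kdiff n (kdiff n w) A = 0"
proof -
  let ?V = "{1..n} - A"
  define g where "g j k = w (insert k (insert j A)) *
      single (var k + var j) (ksign k (insert j A) * ksign j A)" for j k
  have swap: "g k j = - g j k" if "j \<in> ?V" "k \<in> ?V" "j \<noteq> k" for j k
  proof -
    have "ksign j (insert k A) * ksign k A = - (ksign k (insert j A) * ksign j A :: 'a)"
      using that assms by (intro ksign_swap) auto
    hence "g k j = w (insert k (insert j A)) *
        single (var k + var j) (- (ksign k (insert j A) * ksign j A))"
      unfolding g_def by (simp only: insert_commute[of j k A] add.commute[of "var j" "var k"])
    thus ?thesis
      by (simp only: g_def single_uminus mult_minus_right)
  qed
  have "kdiff n (kdiff n w) A = (\<Sum>j\<in>?V. \<Sum>k\<in>?V - {j}. g j k)"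
  proof -
    have "kdiff n w (insert j A) * single (var j) (ksign j A) = (\<Sum>k\<in>?V - {j}. g j k)" for j
      unfolding kdiff_def sum_distrib_right
      by (intro sum.cong) (auto simp only: g_def mult.assoc mult_single)
    thus ?thesis
      by (simp only: kdiff_def[of n _ A])
  qed
  \<comment> \<open>Splitting at the diagonal and swapping the summation on one side pairs each term
    with its negative, without dividing by 2.\<close>
  also have "\<dots> = (\<Sum>j\<in>?V. (\<Sum>k\<in>{k. k \<in> ?V \<and> k < j}. g j k) + (\<Sum>k\<in>{k. k \<in> ?V \<and> j < k}. g j k))"
  proof (rule sum.cong)
    fix j assume "j \<in> ?V"
    have "(\<Sum>k\<in>{k. k \<in> ?V \<and> k < j} \<union> {k. k \<in> ?V \<and> j < k}. g j k) =
        (\<Sum>k\<in>{k. k \<in> ?V \<and> k < j}. g j k) + (\<Sum>k\<in>{k. k \<in> ?V \<and> j < k}. g j k)"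
      by (rule sum.union_disjoint) auto
    moreover have "?V - {j} = {k. k \<in> ?V \<and> k < j} \<union> {k. k \<in> ?V \<and> j < k}"
      by auto
    ultimately show "(\<Sum>k\<in>?V - {j}. g j k) =
        (\<Sum>k\<in>{k. k \<in> ?V \<and> k < j}. g j k) + (\<Sum>k\<in>{k. k \<in> ?V \<and> j < k}. g j k)"
      by (rule ssubst[rotated])
  qed simp
  also have "\<dots> = (\<Sum>j\<in>?V. \<Sum>k\<in>{k. k \<in> ?V \<and> k < j}. g j k) +
      (\<Sum>k\<in>?V. \<Sum>j\<in>{j. j \<in> ?V \<and> j < k}. g j k)"
    using sum.swap_restrict[of ?V ?V g "(<)"] by (simp only: sum.distrib finite_Diff finite_atLeastAtMost)
  also have "(\<Sum>k\<in>?V. \<Sum>j\<in>{j. j \<in> ?V \<and> j < k}. g j k) =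
      (\<Sum>k\<in>?V. \<Sum>j\<in>{j. j \<in> ?V \<and> j < k}. - g k j)"
    by (intro sum.cong refl swap) auto
  finally show ?thesis
    by (simp add: sum_negf)
qed

text \<open>The part of a Koszul chain of multidegree \<open>a\<close> is a chain of the simplex on the support of \<open>a\<close>.\<close>

definition slice :: "(nat set \<Rightarrow> 'a::comm_ring_1 mpoly) \<Rightarrow> monomial \<Rightarrow> nat set \<Rightarrow> 'a" where
  "slice w a A = (if A \<subseteq> keys a then lookup (w A) (a - sqf_mon A) else 0)"

text \<open>The term at \<open>u\<close> and \<open>A\<close> has multidegree
  \<open>u + sqf_mon A\<close>, which the differential preserves. Vertices of the support outside
  \<open>{1..n}\<close> contribute 0 because \<open>w\<close> vanishes there.\<close>

lemma lookup_kdiff: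
  assumes w: "\<And>B. w B \<noteq> 0 \<Longrightarrow> B \<subseteq> {1..n}" and A: "finite A"
  shows "lookup (kdiff n w A) u =
    simplex_diff (keys (u + sqf_mon A)) (slice w (u + sqf_mon A)) A"
proof -
  let ?a = "u + sqf_mon A"
  have keys: "keys ?a = keys u \<union> A"
    using A by (simp add: keys_add_monomial keys_sqf_mon)
  have "lookup (kdiff n w A) u =
      (\<Sum>j\<in>{1..n} - A. if j \<in> keys u then lookup (w (insert j A)) (u - var j) * ksign j A else 0)"
    by (simp only: kdiff_def lookup_sum lookup_mult_single_var)
  also have "\<dots> = (\<Sum>j\<in>keys ?a - A. ksign j A * slice w ?a (insert j A))"
  proof (rule sum.mono_neutral_cong)
    fix j assume j: "j \<in> (keys ?a - A) - ({1..n} - A)"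
    hence "w (insert j A) = 0"
      using w[of "insert j A"] by blast
    thus "ksign j A * slice w ?a (insert j A) = 0"
      by (simp add: slice_def)
  qed (use A in \<open>auto simp: keys slice_def add_minus_sqf_mon_insert mult.commute\<close>)
  finally show ?thesis
    by (simp add: simplex_diff_def)
qed

text \<open>The differential preserves multidegrees, so each slice can be contracted to its own
  vertex \<open>J a\<close>; by the homotopy identity the contraction of a cycle \<open>w\<close>
  has boundary \<open>w\<close>. Since the contraction divides coefficients by the variable of
  \<open>J a\<close>, the set \<open>U\<close> controls which monomials occur in
  \<open>W\<close>.\<close>

lemma kdiff_contraction:
  fixes w :: "nat set \<Rightarrow> 'a::comm_ring_1 mpoly" and J :: "monomial \<Rightarrow> nat"
  assumes w: "\<And>A. w A \<noteq> 0 \<Longrightarrow> A \<in> subsets n i"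
    and J: "\<And>A u. u \<in> keys (w A) \<Longrightarrow> J (u + sqf_mon A) \<in> keys (u + sqf_mon A) \<inter> {1..n}"
    and U: "\<And>A u. \<lbrakk>u \<in> keys (w A); J (u + sqf_mon A) \<notin> A\<rbrakk> \<Longrightarrow> u - var (J (u + sqf_mon A)) \<in> U"
    and cycle: "\<And>A. \<lbrakk>A \<subseteq> {1..n}; Suc (card A) = i\<rbrakk> \<Longrightarrow> kdiff n w A = 0"
  obtains W where "\<And>A. W A \<noteq> 0 \<Longrightarrow> A \<in> subsets n (Suc i)" "\<And>A. keys (W A) \<subseteq> U"
    "\<And>A. A \<in> subsets n i \<Longrightarrow> kdiff n W A = w A"
proof -
  \<comment> \<open>This is \<open>simplex_cone\<close> in each multidegree: the coefficient at
    \<open>u\<close> comes from the monomial of \<open>w (A - {j})\<close> that becomes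
    \<open>u\<close> after division by the variable of \<open>j\<close>.\<close>
  define c where "c A u = (let j = J (u + sqf_mon A) in
    if j \<in> A then ksign j (A - {j}) * lookup (w (A - {j})) (u + var j) else 0)" for A u
  define W where "W A = Abs_poly_mapping (c A)" for A
  have c_nonzero: "\<exists>j. j = J (u + sqf_mon A) \<and> j \<in> A \<and> j \<in> {1..n} \<and> finite A \<and>
      u + var j \<in> keys (w (A - {j})) \<and> A \<in> subsets n (Suc i) \<and> u \<in> U" if "c A u \<noteq> 0" for A u
  proof -
    let ?j = "J (u + sqf_mon A)"
    have j: "?j \<in> A" "u + var ?j \<in> keys (w (A - {?j}))"
      using that by (auto simp: c_def Let_def in_keys_iff split: if_splits)
    hence sub: "A - {?j} \<in> subsets n i"
      by (metis w keys_zero empty_iff)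
    hence fin: "finite A"
      using finite_of_subsets by fastforce
    have a: "u + var ?j + sqf_mon (A - {?j}) = u + sqf_mon A"
      using fin j by (simp add: add.assoc sqf_mon_remove)
    have "?j \<in> {1..n}"
      using J[OF j(2)] a by simp
    moreover from this have "A \<in> subsets n (Suc i)"
      using sub j(1) fin card_Suc_Diff1[of A ?j] by (auto simp: subsets_def)
    moreover have "u \<in> U"
      using U[OF j(2)] a by simp
    ultimately show ?thesis
      using j fin by blast
  qed
  \<comment> \<open>Finite support makes \<open>Abs_poly_mapping\<close> meaningful.\<close>
  have "finite {u. c A u \<noteq> 0}" for A
  proof (cases "finite A")
    case True
    have "{u. c A u \<noteq> 0} \<subseteq> (\<Union>j\<in>A. (\<lambda>v. v - var j) ` keys (w (A - {j})))"
      using c_nonzero by force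
    thus ?thesis
      by (rule finite_subset) (use True in auto)
  next
    case False
    hence "{u. c A u \<noteq> 0} = {}"
      using c_nonzero by blast
    thus ?thesis
      by (metis finite.emptyI)
  qed
  hence lookup_W: "lookup (W A) u = c A u" for A u
    by (simp add: W_def)
  have W: "A \<in> subsets n (Suc i)" if nonzero: "W A \<noteq> 0" for A
  proof -
    obtain u where "lookup (W A) u \<noteq> 0"
      using nonzero by (auto simp: poly_mapping_eq_iff fun_eq_iff)
    thus ?thesis
      using c_nonzero lookup_W by metis
  qed
  have slice_W: "slice W a A = simplex_cone (J a) (slice w a) A" if "A \<subseteq> keys a" for a A
  proof -
    have fin: "finite A"
      using that by (rule finite_subset) simp
    show ?thesis
      using that fin minus_sqf_mon_add[OF fin that] minus_sqf_mon_add_var[OF fin that]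
      by (auto simp: slice_def simplex_cone_def lookup_W c_def Let_def)
  qed
  have "lookup (kdiff n W A) u = lookup (w A) u" if A: "A \<in> subsets n i" for A u
  proof -
    note fin = finite_of_subsets[OF A]
    define a where "a = u + sqf_mon A"
    have A_sub: "A \<subseteq> keys a"
      using fin by (simp add: a_def keys_add_monomial keys_sqf_mon)
    have "lookup (kdiff n W A) u = simplex_diff (keys a) (slice W a) A"
      unfolding a_def using W fin by (intro lookup_kdiff) (auto simp: subsets_def)
    also have "\<dots> = simplex_diff (keys a) (simplex_cone (J a) (slice w a)) A"
      unfolding simplex_diff_def using A_sub by (intro sum.cong) (auto simp: slice_W)
    also have "\<dots> = slice w a A"
    \<comment> \<open>Only in a multidegree that occurs in \<open>w\<close> is \<open>J a\<close>
      known to be a vertex; elsewhere both sides are 0.\<close>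
    proof (cases "\<exists>B. slice w a B \<noteq> 0")
      case True
      then obtain B where B: "B \<subseteq> keys a" "a - sqf_mon B \<in> keys (w B)"
        by (auto simp: slice_def in_keys_iff split: if_splits)
      have "finite B"
        using B(1) by (rule finite_subset) simp
      hence "J a \<in> keys a"
        using J[OF B(2)] minus_sqf_mon_add[OF _ B(1)] by simp
      \<comment> \<open>Where this second homotopy term can be nonzero, it is up to sign a
        coefficient of the boundary of \<open>w\<close> at \<open>A - {J a}\<close>, and
        \<open>w\<close> is a cycle.\<close>
      moreover have "simplex_cone (J a) (simplex_diff (keys a) (slice w a)) A = 0"
      proof (cases "J a \<in> A")
        case True
        let ?B = "A - {J a}" and ?u = "u + var (J a)"
        have a: "?u + sqf_mon ?B = a"
          using True fin by (simp add: a_def add.assoc sqf_mon_remove)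
        have "simplex_diff (keys a) (slice w a) ?B = lookup (kdiff n w ?B) ?u"
          using lookup_kdiff[of w n ?B ?u] w fin by (auto simp: a subsets_def)
        moreover have "kdiff n w ?B = 0"
          using A True fin card_Suc_Diff1[of A "J a"] by (intro cycle) (auto simp: subsets_def)
        ultimately show ?thesis
          by (simp add: simplex_cone_def)
      qed (simp add: simplex_cone_def)
      ultimately show ?thesis
        using simplex_homotopy[of "keys a" "J a" A "slice w a"] A_sub by simp
    next
      case False
      hence "slice w a B = 0" for B
        by blast
      thus ?thesis
        unfolding simplex_diff_def simplex_cone_def by (auto intro!: sum.neutral)
    qed
    also have "\<dots> = lookup (w A) u"
      using A_sub by (simp add: slice_def a_def)
    finally show ?thesis .
  qed
  hence "kdiff n W A = w A" if "A \<in> subsets n i" for A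
    using that by (intro poly_mapping_eqI)
  moreover have "keys (W A) \<subseteq> U" for A
    using c_nonzero lookup_W by (metis in_keys_iff subsetI)
  ultimately show ?thesis
    using that W by blast
qed

section \<open>The Koszul complex with numbered basis\<close>

definition enum_subsets :: "nat \<Rightarrow> nat \<Rightarrow> nat \<Rightarrow> nat set" where
  "enum_subsets n i = (SOME e. bij_betw e {..<n choose i} (subsets n i))"

lemma bij_enum_subsets: "bij_betw (enum_subsets n i) {..<n choose i} (subsets n i)"
proof -
  have "card (subsets n i) = n choose i"
    using n_subsets[of "{1..n}" i] by (simp add: subsets_def)
  hence "\<exists>e. bij_betw e {..<n choose i} (subsets n i)"
    using ex_bij_betw_nat_finite[OF finite_subsets[of n i]] by (simp add: lessThan_atLeast0)
  thus ?thesis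
    unfolding enum_subsets_def by (rule someI_ex)
qed

lemma enum_subsets_in: "b < n choose i \<Longrightarrow> enum_subsets n i b \<in> subsets n i"
  using bij_enum_subsets[of n i] by (auto simp: bij_betw_def)

text \<open>The numbering of the subsets is arbitrary, as signs are computed from the sets
  themselves. At most one \<open>j\<close> contributes to a matrix entry, so the sum only serves to
  avoid naming it.\<close>

definition koszul :: "nat \<Rightarrow> 'a::field free_complex" where
  "koszul n = \<lparr>rk = \<lambda>i. n choose i, gdeg = \<lambda>i _. i,
     coef = \<lambda>i b c. \<Sum>j\<in>{1..n} - enum_subsets n i c.
       if enum_subsets n (Suc i) b = insert j (enum_subsets n i c)
       then single (var j) (ksign j (enum_subsets n i c)) else 0\<rparr>"

lemma koszul_simps [simp]: "rk (koszul n) i = n choose i" "gdeg (koszul n) i b = i"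
  by (simp_all add: koszul_def)

text \<open>Passage from coordinate vectors to functions on sets; the value 0 elsewhere provides the
  support condition required of \<open>w\<close> in \<open>kdiff_contraction\<close>.\<close>

definition coeff_fun :: "nat \<Rightarrow> nat \<Rightarrow> (nat \<Rightarrow> 'a::field mpoly) \<Rightarrow> nat set \<Rightarrow> 'a mpoly" where
  "coeff_fun n i v A =
    (if A \<in> subsets n i then v (inv_into {..<n choose i} (enum_subsets n i) A) else 0)"

lemma coeff_fun_enum: "b < n choose i \<Longrightarrow> coeff_fun n i v (enum_subsets n i b) = v b"
  using bij_enum_subsets[of n i] enum_subsets_in[of b n i]
  by (simp add: coeff_fun_def bij_betw_def inv_into_f_f)

lemma subsetsE:
  assumes "A \<in> subsets n i"
  obtains b where "b < n choose i" "A = enum_subsets n i b"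
  using assms bij_enum_subsets[of n i] by (auto simp: bij_betw_def)

lemma coeff_fun_comp:
  assumes "\<And>A. w A \<noteq> 0 \<Longrightarrow> A \<in> subsets n i"
  shows "coeff_fun n i (\<lambda>b. if b < n choose i then w (enum_subsets n i b) else 0) = w"
proof
  fix A
  let ?v = "\<lambda>b. if b < n choose i then w (enum_subsets n i b) else 0"
  show "coeff_fun n i ?v A = w A"
  proof (cases "A \<in> subsets n i")
    case True
    then obtain b where "b < n choose i" "A = enum_subsets n i b"
      by (rule subsetsE)
    thus ?thesis
      using coeff_fun_enum[of b n i ?v] by simp
  next
    case False
    thus ?thesis
      using assms[of A] by (auto simp: coeff_fun_def)
  qed
qed

lemma bdry_koszul:
  assumes "c < n choose i"
  shows "bdry (koszul n) i v c = kdiff n (coeff_fun n (Suc i) v) (enum_subsets n i c)"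
proof -
  let ?A = "enum_subsets n i c" and ?w = "coeff_fun n (Suc i) v"
  let ?x = "\<lambda>j. single (var j) (ksign j ?A)"
  have A: "?A \<in> subsets n i"
    using assms by (rule enum_subsets_in)
  have "bdry (koszul n) i v c = (\<Sum>b<n choose Suc i. ?w (enum_subsets n (Suc i) b) *
      (\<Sum>j\<in>{1..n} - ?A. if enum_subsets n (Suc i) b = insert j ?A then ?x j else 0))"
    using assms by (simp add: bdry_def koszul_def coeff_fun_enum)
  also have "\<dots> = (\<Sum>B\<in>subsets n (Suc i). ?w B *
      (\<Sum>j\<in>{1..n} - ?A. if B = insert j ?A then ?x j else 0))"
    by (rule sum.reindex_bij_betw[OF bij_enum_subsets])
  also have "\<dots> = (\<Sum>j\<in>{1..n} - ?A. \<Sum>B\<in>subsets n (Suc i).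
      if B = insert j ?A then ?w B * ?x j else 0)"
    unfolding sum_distrib_left by (subst sum.swap) (intro sum.cong refl, simp)
  also have "\<dots> = kdiff n ?w ?A"
    unfolding kdiff_def
  proof (rule sum.cong)
    fix j assume "j \<in> {1..n} - ?A"
    with A have "insert j ?A \<in> subsets n (Suc i)"
      using finite_of_subsets[OF A] by (auto simp: subsets_def)
    thus "(\<Sum>B\<in>subsets n (Suc i). if B = insert j ?A then ?w B * ?x j else 0) =
        ?w (insert j ?A) * ?x j"
      by (simp add: finite_subsets)
  qed simp
  finally show ?thesis .
qed

lemma coef_koszul_keys:
  assumes "u \<in> keys (coef (koszul n) i b c :: 'a::field mpoly)"
  shows "\<exists>j\<in>{1..n}. u = var j"
proof -
  let ?x = "\<lambda>j. if enum_subsets n (Suc i) b = insert j (enum_subsets n i c)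
    then single (var j) (ksign j (enum_subsets n i c) :: 'a) else 0"
  have "u \<in> keys (\<Sum>j\<in>{1..n} - enum_subsets n i c. ?x j)"
    using assms by (simp add: koszul_def)
  then obtain j where "j \<in> {1..n}" "u \<in> keys (?x j)"
    using keys_sum[of ?x "{1..n} - enum_subsets n i c"] by blast
  thus ?thesis
    by (intro bexI[of _ j]) (simp_all split: if_splits)
qed

lemma coef_koszul_polys: "coef (koszul n) i b c \<in> polys n"
  using coef_koszul_keys[of _ n i b c] by (fastforce simp: polys_def monomials_def)

text \<open>The contraction \<open>kdiff_contraction\<close> in coordinates. For
  \<open>i = 0\<close> there is no cycle condition; the requirement that \<open>J\<close> finds a
  variable then excludes the constant monomial.\<close>

lemma koszul_lift:
  fixes v :: "nat \<Rightarrow> 'a::field mpoly" and J :: "monomial \<Rightarrow> nat"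
  assumes v: "\<And>b. b \<ge> n choose i \<Longrightarrow> v b = 0"
    and cycle: "case i of 0 \<Rightarrow> True | Suc k \<Rightarrow> bdry (koszul n) k v = 0"
    and J: "\<And>A b u. \<lbrakk>A \<in> subsets n i; A = enum_subsets n i b; u \<in> keys (v b)\<rbrakk> \<Longrightarrow>
      J (u + sqf_mon A) \<in> keys (u + sqf_mon A) \<inter> {1..n}"
    and U: "\<And>A b u. \<lbrakk>A \<in> subsets n i; A = enum_subsets n i b; u \<in> keys (v b);
      J (u + sqf_mon A) \<notin> A\<rbrakk> \<Longrightarrow> u - var (J (u + sqf_mon A)) \<in> U"
  obtains w where "w \<in> chains (koszul n) {p. keys p \<subseteq> U} (Suc i)" "bdry (koszul n) i w = v"
proof -
  let ?v = "coeff_fun n i v"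
  have supp: "?v A \<noteq> 0 \<Longrightarrow> A \<in> subsets n i" for A
    by (auto simp: coeff_fun_def split: if_splits)
  have key: "\<exists>b. A \<in> subsets n i \<and> A = enum_subsets n i b \<and> u \<in> keys (v b)"
    if "u \<in> keys (?v A)" for A u
  proof -
    have "?v A \<noteq> 0"
      using that by auto
    hence "A \<in> subsets n i"
      by (rule supp)
    moreover from this obtain b where "b < n choose i" "A = enum_subsets n i b"
      by (rule subsetsE)
    ultimately show ?thesis
      using that coeff_fun_enum[of b n i v] by auto
  qed
  have cycle': "kdiff n ?v A = 0" if A: "A \<subseteq> {1..n}" "Suc (card A) = i" for A
  proof -
    obtain k where k: "i = Suc k"
      using A by auto
    with A have "A \<in> subsets n k"
      by (simp add: subsets_def)
    then obtain c where "c < n choose k" "A = enum_subsets n k c"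
      by (rule subsetsE)
    thus ?thesis
      using bdry_koszul[of c n k v] cycle k by simp
  qed
  obtain W where W: "\<And>A. W A \<noteq> 0 \<Longrightarrow> A \<in> subsets n (Suc i)" "\<And>A. keys (W A) \<subseteq> U"
    "\<And>A. A \<in> subsets n i \<Longrightarrow> kdiff n W A = ?v A"
  proof (rule kdiff_contraction[of ?v n i J U])
    show "J (u + sqf_mon A) \<in> keys (u + sqf_mon A) \<inter> {1..n}" if "u \<in> keys (?v A)" for A u
      using key[OF that] J by blast
    show "u - var (J (u + sqf_mon A)) \<in> U" if "u \<in> keys (?v A)" "J (u + sqf_mon A) \<notin> A" for A u
      using key[OF that(1)] that(2) U by blast
  qed (use supp cycle' in auto)
  let ?w = "\<lambda>b. if b < n choose Suc i then W (enum_subsets n (Suc i) b) else 0"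
  have "bdry (koszul n) i ?w c = v c" for c
  proof (cases "c < n choose i")
    case True
    thus ?thesis
      using coeff_fun_comp[of W n "Suc i"] W(1,3) enum_subsets_in[OF True]
      by (simp add: bdry_koszul coeff_fun_enum)
  next
    case False
    thus ?thesis
      using v by (simp add: bdry_def)
  qed
  moreover have "?w \<in> chains (koszul n) {p. keys p \<subseteq> U} (Suc i)"
    using W(2) by (simp add: chains_def)
  ultimately show ?thesis
    using that by blast
qed

section \<open>The Koszul complex resolves the residue field\<close>

lemma bdry_koszul_chains:
  assumes "v \<in> chains (koszul n) (polys n) (Suc i)"
  shows "bdry (koszul n) i v \<in> chains (koszul n) (polys n) i"
  using assms by (auto simp: chains_def bdry_def intro!: polys_sum polys_mult coef_koszul_polys)

lemma bdry_bdry_koszul: "bdry (koszul n) i (bdry (koszul n) (Suc i) v) = 0"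
proof
  fix c
  let ?v = "bdry (koszul n) (Suc i) v"
  show "bdry (koszul n) i ?v c = 0 c"
  proof (cases "c < n choose i")
    case True
    let ?A = "enum_subsets n i c"
    have A: "?A \<in> subsets n i"
      using True by (rule enum_subsets_in)
    have "coeff_fun n (Suc i) ?v B = kdiff n (coeff_fun n (Suc (Suc i)) v) B"
      if "B \<in> subsets n (Suc i)" for B
      using that by (metis subsetsE coeff_fun_enum bdry_koszul)
    moreover have "insert j ?A \<in> subsets n (Suc i)" if "j \<in> {1..n} - ?A" for j
      using that A finite_of_subsets[OF A] by (auto simp: subsets_def)
    ultimately have "kdiff n (coeff_fun n (Suc i) ?v) ?A =
        kdiff n (kdiff n (coeff_fun n (Suc (Suc i)) v)) ?A"
      unfolding kdiff_def[of n _ ?A] by (intro sum.cong) auto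
    thus ?thesis
      using True finite_of_subsets[OF A] by (simp add: bdry_koszul kdiff_kdiff)
  next
    case False
    thus ?thesis
      by (simp add: bdry_def)
  qed
qed

lemma augm_koszul: "augm (koszul n) (\<lambda>_. 1) v = lookup (v 0) 0"
  by (simp add: augm_def One_nat_def)

text \<open>Every nonzero multidegree has a variable to contract to, and over S division by it is
  harmless. Multidegree 0 occurs only in homological degree 0, where the augmentation accounts for
  it.\<close>

lemma resolution_koszul: "resolution n (koszul n) (\<lambda>_. 1 :: 'a::field)"
proof
  let ?K = "koszul n :: 'a free_complex"
  show "coef ?K i b c \<in> polys n" for i b c
    by (rule coef_koszul_polys)
  show "tdeg u + gdeg ?K i c = gdeg ?K (Suc i) b" if "u \<in> keys (coef ?K i b c)" for i b c u
    using coef_koszul_keys[OF that] by auto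
  have lift: "v \<in> bdry ?K i ` chains ?K (polys n) (Suc i)"
    if v: "v \<in> chains ?K (polys n) i" and cycle: "case i of 0 \<Rightarrow> True | Suc k \<Rightarrow> bdry ?K k v = 0"
      and nonzero: "i = 0 \<Longrightarrow> lookup (v 0) 0 = 0" for v i
  proof -
    define J where "J = (\<lambda>a. SOME j. j \<in> keys (a :: monomial))"
    have key: "u \<in> monomials n \<and> (i = 0 \<longrightarrow> u \<noteq> 0)" if "u \<in> keys (v b)" for u b
    proof -
      have b: "b < n choose i"
      proof (rule ccontr)
        assume "\<not> b < n choose i"
        hence "v b = 0"
          using v by (simp add: chains_def)
        with that show False
          by simp
      qed
      hence "v b \<in> polys n"
        using v by (simp add: chains_def)
      with that b nonzero show ?thesis
        by (auto simp: polys_def in_keys_iff)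
    qed
    have J: "J (u + sqf_mon A) \<in> keys (u + sqf_mon A) \<inter> {1..n}"
      if "A \<in> subsets n i" "u \<in> keys (v b)" for A b u
    proof -
      have fin: "finite A"
        using that(1) by (rule finite_of_subsets)
      \<comment> \<open>In positive homological degree \<open>A\<close> is nonempty; in degree 0 the
        kernel of the augmentation contains no constant term.\<close>
      have "keys (u + sqf_mon A) \<noteq> {}"
      proof (cases "i = 0")
        case True
        hence "keys u \<noteq> {}"
          using key[OF that(2)] by simp
        thus ?thesis
          by (simp add: keys_add_monomial)
      next
        case False
        hence "A \<noteq> {}"
          using that(1) by (auto simp: subsets_def)
        thus ?thesis
          using fin by (simp add: keys_add_monomial keys_sqf_mon)
      qed
      hence "J (u + sqf_mon A) \<in> keys (u + sqf_mon A)"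
        unfolding J_def by (simp add: some_in_eq)
      moreover have "keys (u + sqf_mon A) \<subseteq> {1..n}"
        using key[OF that(2)] that(1) fin
        by (simp add: keys_add_monomial keys_sqf_mon monomials_def subsets_def)
      ultimately show ?thesis
        by blast
    qed
    have U: "u - var (J (u + sqf_mon A)) \<in> monomials n" if "u \<in> keys (v b)" for A b u
    proof -
      have "keys (u - var (J (u + sqf_mon A))) \<subseteq> keys u"
        by (auto simp: in_keys_iff lookup_minus)
      with key[OF that] show ?thesis
        by (auto simp: monomials_def)
    qed
    obtain w where "w \<in> chains ?K {p. keys p \<subseteq> monomials n} (Suc i)" "bdry ?K i w = v"
    proof (rule koszul_lift[of n i v J "monomials n"])
      show "v b = 0" if "b \<ge> n choose i" for b
        using v that by (simp add: chains_def)
    qed (use cycle J U in blast)+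
    thus ?thesis
      by (auto simp: polys_def)
  qed
  show "{v \<in> chains ?K (polys n) (Suc i). bdry ?K i v = 0} =
      bdry ?K (Suc i) ` chains ?K (polys n) (Suc (Suc i))" for i
    using lift[of _ "Suc i"] by (auto simp: bdry_bdry_koszul intro: bdry_koszul_chains)
  \<comment> \<open>Each summand of the boundary is a multiple of a variable.\<close>
  have "lookup (bdry ?K 0 v 0) 0 = 0" for v
  proof -
    have "bdry ?K 0 v 0 = kdiff n (coeff_fun n (Suc 0) v) (enum_subsets n 0 0)"
      using bdry_koszul[of 0 n 0 v] by simp
    thus ?thesis
      by (simp only: kdiff_def lookup_sum lookup_mult_single_var) simp
  qed
  thus "{v \<in> chains ?K (polys n) 0. augm ?K (\<lambda>_. 1) v = 0} =
      bdry ?K 0 ` chains ?K (polys n) (Suc 0)"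
    using lift[of _ 0] by (auto simp: augm_koszul intro: bdry_koszul_chains)
  have "t \<in> augm ?K (\<lambda>_. 1) ` chains ?K (polys n) 0" for t
    by (rule image_eqI[of _ _ "\<lambda>b. if b = 0 then single 0 t else 0"])
      (auto simp: augm_koszul chains_def polys_def monomials_def)
  thus "augm ?K (\<lambda>_. 1) ` chains ?K (polys n) 0 = UNIV"
    by blast
qed simp_all

section \<open>Betti numbers of squarefree monomial ideals\<close>

text \<open>The Koszul complex shows that resolutions exist, so the one chosen in
  \<open>betti\<close> is a resolution, to which the vanishing transfers. Equal spaces of cycles and
  boundaries give difference 0.\<close>

lemma betti_eq_0:
  fixes I :: "'a::field mpoly set"
  assumes I: "ideal I (poly_ring n)"
    and koszul: "tor_cycles (koszul n) I i d \<subseteq> tor_boundaries (koszul n) I i d"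
  shows "betti n I i d = 0"
proof -
  define F where "F = (SOME F :: 'a free_complex. resolves_field n F)"
  have "resolves_field n (koszul n :: 'a free_complex)"
    using resolution_koszul resolves_field_iff_resolution by blast
  hence "resolves_field n F"
    unfolding F_def by (rule someI)
  then obtain a where F: "resolution n F a"
    unfolding resolves_field_iff_resolution by blast
  have "tor_cycles F I i d = tor_boundaries F I i d"
    using tor_vanishing_transfer[OF F resolution_koszul I koszul]
      resolution.tor_boundaries_subset[OF F I] by blast
  thus ?thesis
    by (simp add: betti_def F_def[symmetric])
qed

text \<open>The vanishing criterion: \<open>V\<close> consists of the monomials of \<open>I\<close>,
  and in each multidegree a variable is needed by which the coefficients can be divided without
  leaving \<open>V\<close>. If the variable belongs to \<open>A\<close>, the contraction kills the
  term and nothing has to be divided.\<close>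

lemma koszul_cycles_subset_boundaries:
  fixes I :: "'a::field mpoly set"
  assumes I: "I = {p. keys p \<subseteq> V}" and V: "V \<subseteq> monomials n"
    and J: "\<And>A u. \<lbrakk>A \<in> subsets n i; u \<in> V; tdeg u + i = d\<rbrakk> \<Longrightarrow>
      J (u + sqf_mon A) \<in> keys (u + sqf_mon A) \<and>
      (J (u + sqf_mon A) \<notin> A \<longrightarrow> u - var (J (u + sqf_mon A)) \<in> V)"
  shows "tor_cycles (koszul n) I i d \<subseteq> tor_boundaries (koszul n) I i d"
proof
  fix v assume "v \<in> tor_cycles (koszul n) I i d"
  hence v: "v \<in> chains_deg (koszul n) I i d"
    and cycle: "case i of 0 \<Rightarrow> True | Suc k \<Rightarrow> bdry (koszul n) k v = 0"
    by (simp_all add: tor_cycles_def)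
  have pad: "v b = 0" if "b \<ge> n choose i" for b
    using v that by (simp add: chains_deg_def chains_def)
  have key: "u \<in> V \<and> tdeg u + i = d" if "u \<in> keys (v b)" for u b
  proof -
    have "b < n choose i"
      using pad[of b] that by (cases "b < n choose i") auto
    with v that show ?thesis
      by (auto simp: chains_deg_def chains_def I)
  qed
  obtain w where w: "w \<in> chains (koszul n) {p. keys p \<subseteq> {u \<in> V. tdeg u + Suc i = d}} (Suc i)"
    "bdry (koszul n) i w = v"
  proof (rule koszul_lift[of n i v J "{u \<in> V. tdeg u + Suc i = d}"])
    fix A b u assume A: "A \<in> subsets n i" and u: "u \<in> keys (v b)"
    have fin: "finite A"
      using A by (rule finite_of_subsets)
    have "keys (u + sqf_mon A) \<subseteq> {1..n}"
      using key[OF u] A V fin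
      by (auto simp: keys_add_monomial keys_sqf_mon monomials_def subsets_def)
    with J[OF A] key[OF u] show "J (u + sqf_mon A) \<in> keys (u + sqf_mon A) \<inter> {1..n}"
      by blast
    assume j: "J (u + sqf_mon A) \<notin> A"
    hence "J (u + sqf_mon A) \<in> keys u"
      using J[OF A] key[OF u] fin by (auto simp: keys_add_monomial keys_sqf_mon)
    \<comment> \<open>Division lowers the degree of the coefficient by one, which the passage from
      \<open>i\<close> to \<open>Suc i\<close> compensates.\<close>
    from arg_cong[OF minus_var_add_var[OF this], of tdeg]
    have "tdeg (u - var (J (u + sqf_mon A))) + Suc i = d"
      using key[OF u] by (simp add: tdeg_add)
    thus "u - var (J (u + sqf_mon A)) \<in> {u \<in> V. tdeg u + Suc i = d}"
      using J[OF A] key[OF u] j by blast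
  qed (use pad cycle in auto)
  have "w \<in> chains_deg (koszul n) I (Suc i) d"
    using w(1) by (auto simp: chains_deg_def chains_def I)
  with w(2) show "v \<in> tor_boundaries (koszul n) I i d"
    by (auto simp: tor_boundaries_def)
qed

section \<open>Vanishing for an ideal with squarefree generators\<close>

locale squarefree_generators =
  fixes n :: nat and M :: "monomial set" and I :: "'a::field mpoly set"
  assumes gens: "M \<subseteq> monomials n"
    and squarefree: "m \<in> M \<Longrightarrow> squarefree_monomial m"
    and I_def: "I = monomial_ideal n M"
begin

lemma ideal_I: "ideal I (poly_ring n)"
  unfolding I_def by (rule monomial_ideal_eq(1)[OF gens])

lemma I_eq: "I = {p. keys p \<subseteq> multiples n M}"
  unfolding I_def by (rule monomial_ideal_eq(2)[OF gens])

lemma multiples_subset: "multiples n M \<subseteq> monomials n"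
  by (auto simp: multiples_def)

text \<open>A squarefree generator uses the variable at most once, so a second factor of it lies in
  the cofactor and can be cancelled.\<close>

lemma multiples_minus_var:
  assumes "u \<in> multiples n M" "lookup u j \<ge> 2"
  shows "u - var j \<in> multiples n M"
proof -
  obtain m w where m: "m \<in> M" "u = m + w"
    using assms(1) by (auto simp: multiples_def)
  have "lookup m j \<le> 1"
    using squarefree[OF m(1)] by (simp add: squarefree_monomial_def)
  hence "j \<in> keys w"
    using assms(2) m(2) by (simp add: in_keys_iff lookup_add)
  hence u: "u = m + (w - var j) + var j"
    using minus_var_add_var[of j w] by (simp add: m(2) add.assoc)
  moreover have "u \<in> monomials n"
    using assms(1) multiples_subset by blast
  ultimately have "m + (w - var j) \<in> monomials n"
    using monomials_add_iff by metis
  moreover have "u - var j = m + (w - var j)"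
    by (subst u) simp
  ultimately show ?thesis
    using m(1) by (auto simp: multiples_def)
qed

text \<open>A multidegree of total degree above \<open>n\<close> in \<open>n\<close> variables has
  some exponent at least 2; the contraction goes to that variable. If it is not in \<open>A\<close>,
  the whole exponent belongs to the coefficient, which stays in \<open>I\<close> after
  division.\<close>

lemma betti_above_n:
  assumes "d > n"
  shows "betti n I i d = 0"
proof (rule betti_eq_0[OF ideal_I koszul_cycles_subset_boundaries[OF I_eq multiples_subset]])
  let ?J = "\<lambda>a. SOME j. lookup a j \<ge> 2"
  fix A u assume A: "A \<in> subsets n i" and u: "u \<in> multiples n M" "tdeg u + i = d"
  let ?a = "u + sqf_mon A"
  have fin: "finite A"
    using A by (rule finite_of_subsets)
  have keys: "keys ?a \<subseteq> {1..n}"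
    using u(1) A multiples_subset fin
    by (auto simp: keys_add_monomial keys_sqf_mon monomials_def subsets_def)
  have "\<exists>j. lookup ?a j \<ge> 2"
  proof (rule ccontr)
    assume "\<not> ?thesis"
    hence "lookup ?a j \<le> 1" for j
      by (metis not_less_eq_eq numeral_2_eq_2 One_nat_def)
    hence "tdeg ?a \<le> (\<Sum>j\<in>{1..n}. 1)"
      unfolding tdeg_superset[OF finite_atLeastAtMost keys] by (intro sum_mono)
    moreover have "tdeg ?a = d"
      using A u(2) fin by (simp add: tdeg_add tdeg_sqf_mon subsets_def)
    ultimately show False
      using assms by simp
  qed
  hence j: "lookup ?a (?J ?a) \<ge> 2"
    by (rule someI_ex)
  moreover have "lookup u (?J ?a) \<ge> 2" if "?J ?a \<notin> A"
    using j that fin by (simp add: lookup_add lookup_sqf_mon)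
  ultimately show "?J ?a \<in> keys ?a \<and> (?J ?a \<notin> A \<longrightarrow> u - var (?J ?a) \<in> multiples n M)"
    using multiples_minus_var[OF u(1)] by (auto simp: in_keys_iff)
qed

text \<open>The coefficients would have degree \<open>j\<close>, where \<open>I\<close> has no
  monomials. The criterion holds vacuously, and the constant \<open>J\<close> is a dummy.\<close>

lemma betti_below_initial_degree:
  assumes "has_initial_degree I l" "j < l"
  shows "betti n I i (i + j) = 0"
proof (rule betti_eq_0[OF ideal_I
      koszul_cycles_subset_boundaries[OF I_eq multiples_subset, where J = "\<lambda>_. 0"]])
  fix A u assume u: "u \<in> multiples n M" "tdeg u + i = i + j"
  hence "mon u \<in> hom_comp I j"
    by (simp add: hom_comp_def I_eq mon_def)
  hence "mon u = (0 :: 'a mpoly)"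
    using assms by (auto simp: has_initial_degree_def)
  hence "lookup (mon u :: 'a mpoly) u = 0"
    by simp
  hence False
    by (simp add: mon_def)
  thus "0 \<in> keys (u + sqf_mon A) \<and> (0 \<notin> A \<longrightarrow> u - var 0 \<in> multiples n M)" ..
qed

lemma initial_degree_generator:
  assumes "has_initial_degree I l"
  obtains m where "m \<in> M" "tdeg m \<le> l"
proof -
  \<comment> \<open>Since 0 is an element, \<open>hom_comp I l\<close> differing from
    \<open>{0}\<close> yields a nonzero element.\<close>
  have "0 \<in> hom_comp I l"
    by (simp add: hom_comp_def ideal_0[OF ideal_I])
  then obtain p where p: "p \<in> hom_comp I l" "p \<noteq> 0"
    using assms by (auto simp: has_initial_degree_def)
  then obtain u where "u \<in> keys p"
    by (metis all_not_in_conv keys_eq_empty)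
  hence "u \<in> multiples n M" "tdeg u = l"
    using p(1) by (auto simp: hom_comp_def I_eq)
  thus ?thesis
    using that by (auto simp: multiples_def tdeg_add)
qed

text \<open>A monomial of degree \<open>n\<close> in \<open>I\<close> is either divisible by the
  square of a variable or equal to the product of all variables. In the latter case \<open>m\<close>
  misses some variable, and dividing by that one leaves a multiple of \<open>m\<close>.\<close>

lemma betti_0_n:
  assumes m: "m \<in> M" "tdeg m < n"
  shows "betti n I 0 n = 0"
proof (rule betti_eq_0[OF ideal_I koszul_cycles_subset_boundaries[OF I_eq multiples_subset]])
  let ?J = "\<lambda>u. SOME j. j \<in> keys u \<and> u - var j \<in> multiples n M"
  fix A u assume A: "A \<in> subsets n 0" and u: "u \<in> multiples n M" "tdeg u + 0 = n"
  have keys: "keys u \<subseteq> {1..n}" "keys m \<subseteq> {1..n}"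
    using u(1) m(1) gens by (auto simp: multiples_def monomials_def)
  have "\<exists>j. j \<in> keys u \<and> u - var j \<in> multiples n M"
  proof (cases "\<exists>j. lookup u j \<ge> 2")
    case True
    then obtain j where "lookup u j \<ge> 2"
      by blast
    thus ?thesis
      using multiples_minus_var[OF u(1)] by (intro exI[of _ j]) (auto simp: in_keys_iff)
  next
    case False
    hence le: "lookup u j \<le> 1" for j
      by (metis not_less_eq_eq numeral_2_eq_2 One_nat_def)
    have full: "lookup u j = 1" if "j \<in> {1..n}" for j
    proof (rule ccontr)
      assume "lookup u j \<noteq> 1"
      hence "lookup u j < 1"
        using le[of j] by simp
      hence "tdeg u < (\<Sum>j\<in>{1..n}. 1)"
        unfolding tdeg_superset[OF finite_atLeastAtMost keys(1)]
        using that le by (intro sum_strict_mono_ex1) auto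
      with u(2) show False
        by simp
    qed
    have "\<exists>j\<in>{1..n}. lookup m j = 0"
    proof (rule ccontr)
      assume "\<not> ?thesis"
      hence "lookup m j \<ge> 1" if "j \<in> {1..n}" for j
        using that by (metis less_one not_le)
      hence "(\<Sum>j\<in>{1..n}. 1) \<le> tdeg m"
        unfolding tdeg_superset[OF finite_atLeastAtMost keys(2)] by (intro sum_mono)
      with m(2) show False
        by simp
    qed
    then obtain j where j: "j \<in> {1..n}" "lookup m j = 0"
      by blast
    have "lookup m i \<le> lookup (u - var j) i" for i
    proof (cases "i \<in> {1..n}")
      case True
      thus ?thesis
        using full squarefree[OF m(1)] j(2)
        by (auto simp: lookup_minus lookup_single when_def squarefree_monomial_def)
    next
      case False
      hence "i \<notin> keys m"
        using keys by blast
      thus ?thesis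
        by (simp add: in_keys_iff)
    qed
    hence "u - var j = m + (u - var j - m)"
      by (intro poly_mapping_eqI) (simp add: lookup_add lookup_minus[of _ m])
    moreover have "keys (u - var j) \<subseteq> keys u"
      by (auto simp: in_keys_iff lookup_minus)
    ultimately have "u - var j \<in> multiples n M"
      using keys m(1) by (auto simp: multiples_def monomials_def)
    moreover have "j \<in> keys u"
      using full[OF j(1)] by (simp add: in_keys_iff)
    ultimately show ?thesis
      by blast
  qed
  hence "?J u \<in> keys u \<and> u - var (?J u) \<in> multiples n M"
    by (rule someI_ex)
  moreover have "A = {}"
    using A finite_of_subsets[OF A] by (simp add: subsets_def)
  ultimately show "?J (u + sqf_mon A) \<in> keys (u + sqf_mon A) \<and> (?J (u + sqf_mon A) \<notin> A \<longrightarrow>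
      u - var (?J (u + sqf_mon A)) \<in> multiples n M)"
    by (simp add: sqf_mon_def)
qed

end

section \<open>Counting the corners by their degrees\<close>

theorem proposition3p9:
  fixes n l :: nat and I :: "'a::field mpoly set"
  assumes "n \<ge> 5"
    and "squarefree_strongly_stable n I"
    and "has_initial_degree I l"
    and "l \<ge> 3"
    and "l < n"
    and "\<exists>k. is_corner n I k l"
  shows "finite {(k, j). is_corner n I k j} \<and> card {(k, j). is_corner n I k j} \<le> n - l"
proof -
  let ?C = "{(k, j). is_corner n I k j}"
  have "squarefree_monomial_ideal n I"
    using assms(2) by (simp add: squarefree_strongly_stable_def)
  then obtain M where "squarefree_generators n M I"
    by (auto simp: squarefree_monomial_ideal_def squarefree_generators_def)
  then interpret squarefree_generators n M I .
  obtain m where m: "m \<in> M" "tdeg m < n"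
    using initial_degree_generator[OF assms(3)] assms(5) by (metis le_less_trans)
  have range: "j \<in> {l..<n}" if "is_corner n I k j" for k j
  proof -
    have nonzero: "betti n I k (k + j) \<noteq> 0"
      using that by (simp add: is_corner_def)
    hence "l \<le> j" "k + j \<le> n"
      using betti_below_initial_degree[OF assms(3), of j k] betti_above_n[of "k + j" k]
      by (force simp: not_le)+
    \<comment> \<open>For \<open>j = n\<close> the bound \<open>k + j \<le> n\<close> forces
      \<open>k = 0\<close>, the case treated by \<open>betti_0_n\<close>.\<close>
    moreover have "j \<noteq> n"
      using nonzero betti_0_n[OF m] \<open>k + j \<le> n\<close> by auto
    ultimately show ?thesis
      by simp
  qed
  \<comment> \<open>Of two corners in the same degree, the one with smaller \<open>k\<close> forces
    the Betti number of the other to vanish.\<close>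
  have "inj_on snd ?C"
  proof (rule inj_onI, clarsimp)
    fix k k' j assume "is_corner n I k j" "is_corner n I k' j"
    thus "k = k'"
      unfolding is_corner_def by (metis le_cases order_refl prod.inject)
  qed
  moreover have "snd ` ?C \<subseteq> {l..<n}"
    using range by auto
  ultimately show ?thesis
    using inj_on_finite[of snd ?C "{l..<n}"] card_inj_on_le[of snd ?C "{l..<n}"] by simp
qed

end
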